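(* Let $Q=[u_1,\dots,u_n]\subset\mathbb{S}^2$ with $n\ge 4$ be a spherical polygon not contained in any closed hemisphere. Let $D^+$ be the number of self-intersections of $Q$ and $I$ the number of inflections of $Q$. Then $2D^++I\ge 4$.
   Context: A spherical polygon $Q=[u_1,\dots,u_n]$ is a cyclic sequence of points of $\mathbb{S}^2$ (indices mod $n$) whose edges are the minimal great-circle arcs from $u_i$ to $u_{i+1}$. Standing assumption: no three vertices of $Q$ lie on a common great circle. A self-intersection is a pair of non-adjacent edges that intersect. With $[a,b,c]$ the determinant of $a,b,c\in\mathbb{R}^3$, the pair $\{u_i,u_{i+1}\}$ is an inflection if $[u_{i-1},u_i,u_{i+1}]$ and $[u_i,u_{i+1},u_{i+2}]$ have opposite signs. *)

theory Defs
  imports "HOL-Analysis.Analysis"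
begin

text \<open>A spherical polygon with n vertices is given by u :: nat \<Rightarrow> real^3,
  vertex indices read modulo n (vertices u 0, ..., u (n-1)).\<close>

definition det3 :: "real^3 \<Rightarrow> real^3 \<Rightarrow> real^3 \<Rightarrow> real" where
  "det3 a b c = det (vector [a, b, c] :: real^3^3)"

text \<open>Minimal great-circle arc from a to b (a, b unit vectors, not antipodal).\<close>
definition sarc :: "real^3 \<Rightarrow> real^3 \<Rightarrow> (real^3) set" where
  "sarc a b = {x. \<exists>t\<in>{0..1}. x = ((1 - t) *\<^sub>R a + t *\<^sub>R b) /\<^sub>R norm ((1 - t) *\<^sub>R a + t *\<^sub>R b)}"

definition vtx :: "(nat \<Rightarrow> real^3) \<Rightarrow> nat \<Rightarrow> nat \<Rightarrow> real^3" where
  "vtx u n i = u (i mod n)"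

definition edge :: "(nat \<Rightarrow> real^3) \<Rightarrow> nat \<Rightarrow> nat \<Rightarrow> (real^3) set" where
  "edge u n i = sarc (vtx u n i) (vtx u n (i + 1))"

definition self_intersections :: "(nat \<Rightarrow> real^3) \<Rightarrow> nat \<Rightarrow> (nat \<times> nat) set" where
  "self_intersections u n = {(i, j). i < j \<and> j < n \<and> j \<noteq> i + 1 \<and> \<not> (i = 0 \<and> j = n - 1)
      \<and> edge u n i \<inter> edge u n j \<noteq> {}}"

text \<open>The pair {u_i, u_(i+1)} is an inflection (i < n).\<close>
definition inflections :: "(nat \<Rightarrow> real^3) \<Rightarrow> nat \<Rightarrow> nat set" where
  "inflections u n = {i. i < n \<and>
      det3 (vtx u n (i + n - 1)) (vtx u n i) (vtx u n (i + 1)) *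
      det3 (vtx u n i) (vtx u n (i + 1)) (vtx u n (i + 2)) < 0}"

definition in_closed_hemisphere :: "(nat \<Rightarrow> real^3) \<Rightarrow> nat \<Rightarrow> bool" where
  "in_closed_hemisphere u n \<longleftrightarrow> (\<exists>v::real^3. v \<noteq> 0 \<and> (\<forall>i<n. v \<bullet> u i \<ge> 0))"

end

theory Submission
  imports Defs "HOL-Number_Theory.Cong"
begin

text \<open>
  Everything is expressed by the signs of the determinants of triples of vertices, so that crossings of arcs and
  positions relative to a triangle are propositional consequences of the Grassmann-Pluecker relations.

  The proof is by induction on the number \<open>n\<close> of vertices; for \<open>n = 4\<close> the origin is a positive combination of the
  vertices and all four turns alternate. If the triangle at a vertex contains no other vertex (the vertex is an ear),
  deleting this vertex does not increase \<open>2D + I\<close>; so it remains to find an ear whose deletion leaves a polygon that is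
  not in a hemisphere. At most three vertices are indispensable in this sense, and a vertex inside the triangle of
  three others never is.

  Let the polygon be simple with fewer than four inflections. If the triangle at \<open>c\<close> is not empty, its vertex \<open>p\<close> first
  met when rotating about an end of the triangle is joined to \<open>c\<close> by an uncrossed chord, and turns opposite to \<open>c\<close>. If
  \<open>c\<close> were an end of an inflection, the chord would cut off a polygon that turns in one direction except at \<open>c\<close> and \<open>p\<close>;
  by induction it lies in a hemisphere, hence so does the rest of the polygon, which it encloses. So both ends of an
  inflection are ears. If no ear can be deleted, some deletable \<open>c\<close> is not an ear and \<open>p\<close> is not an ear either; between
  \<open>c\<close> and \<open>p\<close> there are inflections on both sides, giving four ears, one of which can be deleted after all.

  With one crossing and no inflection, the crossing cuts the polygon into two loops. The loop that turns the other way
  at the crossing lies in a hemisphere by induction, and it encloses the other loop.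

  In place of the Jordan curve theorem it suffices to know that a closed polygon crosses the boundary of a triangle an
  even number of times.
\<close>

section \<open>Orientation signs and crossing arcs\<close>

lemma det3_expand: "det3 a b c = a$1*b$2*c$3 + a$2*b$3*c$1 + a$3*b$1*c$2 - a$1*b$3*c$2 - a$2*b$1*c$3 - a$3*b$2*c$1"
  by (simp add: det3_def det_3)

lemma det3_same [simp]: "det3 a a b = 0" "det3 a b a = 0" "det3 b a a = 0"
  by (simp_all add: det3_expand)

lemma grassmann_pluecker: "det3 v a b * det3 v c d - det3 v a c * det3 v b d + det3 v a d * det3 v b c = 0"
  unfolding det3_expand by algebra

abbreviation pos :: "real^3 \<Rightarrow> real^3 \<Rightarrow> real^3 \<Rightarrow> bool" where
  "pos a b c \<equiv> 0 < det3 a b c"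

text \<open>The signs of three products with \<open>x x' - y y' + z z' = 0\<close>: the three terms do not all have the same sign.\<close>

definition sign_relation :: "bool \<Rightarrow> bool \<Rightarrow> bool \<Rightarrow> bool \<Rightarrow> bool \<Rightarrow> bool \<Rightarrow> bool" where
  "sign_relation x x' y y' z z' \<longleftrightarrow> \<not> ((x = x') \<and> (y = (\<not> y')) \<and> (z = z')) \<and> ((x = x') \<or> (y = (\<not> y')) \<or> (z = z'))"

lemma sign_relation_of_sum:
  assumes "x * x' - y * y' + z * z' = (0::real)" "x \<noteq> 0" "x' \<noteq> 0" "y \<noteq> 0" "y' \<noteq> 0" "z \<noteq> 0" "z' \<noteq> 0"
  shows "sign_relation (x > 0) (x' > 0) (y > 0) (y' > 0) (z > 0) (z' > 0)"
proof -
  have s: "(s > 0 \<longleftrightarrow> t > 0) \<longleftrightarrow> s * t > 0" if "s \<noteq> 0" "t \<noteq> 0" for s t :: real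
    using that by (auto simp: zero_less_mult_iff)
  have t: "s * t < 0 \<longleftrightarrow> \<not> s * t > 0" if "s \<noteq> 0" "t \<noteq> 0" for s t :: real
    using that by (auto simp: not_less le_less)
  have y: "(y > 0 \<longleftrightarrow> \<not> y' > 0) \<longleftrightarrow> y * y' < 0" using s[of y y'] t[of y y'] assms by blast
  show ?thesis
    unfolding sign_relation_def s[OF assms(2,3)] s[OF assms(6,7)] y
    using assms(1) t[OF assms(2,3)] t[OF assms(6,7)] t[OF assms(4,5)] by linarith
qed

definition general_position :: "(real^3) set \<Rightarrow> bool" where
  "general_position S \<longleftrightarrow> (\<forall>x\<in>S. \<forall>y\<in>S. \<forall>z\<in>S. x \<noteq> y \<and> y \<noteq> z \<and> x \<noteq> z \<longrightarrow> det3 x y z \<noteq> 0)"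

lemma general_position_subset: "general_position S \<Longrightarrow> T \<subseteq> S \<Longrightarrow> general_position T"
  unfolding general_position_def by blast

lemma det3_permute:
  assumes "det3 a b c = x"
  shows "det3 b a c = - x" "det3 a c b = - x" "det3 c b a = - x" "det3 b c a = x" "det3 c a b = x"
  unfolding assms[symmetric] by (simp_all add: det3_expand)

lemma even_of_bool: "even (of_bool P :: nat) \<longleftrightarrow> \<not> P"
  by simp

lemma neg_iff_not_pos: "x \<noteq> 0 \<Longrightarrow> x < 0 \<longleftrightarrow> \<not> 0 < x" for x :: real
  by auto

text \<open>These are the signs for which \<open>a, b, p, q\<close> satisfy a linear relation with sign pattern \<open>(+, +, -, -)\<close>. Arcs that
  share an endpoint do not cross in this sense, since a determinant vanishes.\<close>

definition arcs_cross :: "real^3 \<Rightarrow> real^3 \<Rightarrow> real^3 \<Rightarrow> real^3 \<Rightarrow> bool" where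
  "arcs_cross a b p q \<longleftrightarrow>
     det3 a b p > 0 \<and> det3 a b q < 0 \<and> det3 a p q < 0 \<and> det3 b p q > 0 \<or>
     det3 a b p < 0 \<and> det3 a b q > 0 \<and> det3 a p q > 0 \<and> det3 b p q < 0"

text \<open>By Cramer's rule these signs say that \<open>x\<close> is a positive combination of
  \<open>a\<close>, \<open>b\<close>, \<open>c\<close>, so it lies inside their spherical triangle;
  the two disjuncts are the two orientations.\<close>

definition in_cone :: "real^3 \<Rightarrow> real^3 \<Rightarrow> real^3 \<Rightarrow> real^3 \<Rightarrow> bool" where
  "in_cone a b c x \<longleftrightarrow>
     det3 a b c > 0 \<and> det3 a b x > 0 \<and> det3 b c x > 0 \<and> det3 a c x < 0 \<or>
     det3 a b c < 0 \<and> det3 a b x < 0 \<and> det3 b c x < 0 \<and> det3 a c x > 0"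

text \<open>Seen from \<open>v\<close>, the directions of \<open>x, y, z\<close> are in counterclockwise order: at least two of the three angles are less
  than a straight angle.\<close>

definition ccw :: "real^3 \<Rightarrow> real^3 \<Rightarrow> real^3 \<Rightarrow> real^3 \<Rightarrow> bool" where
  "ccw v x y z \<longleftrightarrow> pos v x y \<and> pos v y z \<or> pos v y z \<and> pos v z x \<or> pos v z x \<and> pos v x y"

lemma arcs_cross_commute: "arcs_cross a b p q \<longleftrightarrow> arcs_cross p q a b" "arcs_cross a b p q \<longleftrightarrow> arcs_cross b a p q" "arcs_cross a b p q \<longleftrightarrow> arcs_cross a b q p"
  unfolding arcs_cross_def
  by (auto simp: det3_permute[of a b p, OF refl] det3_permute[of a b q, OF refl] det3_permute[of a p q, OF refl] det3_permute[of b p q, OF refl])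

lemma arcs_cross_same [simp]: "\<not> arcs_cross a b a q" "\<not> arcs_cross a b p a" "\<not> arcs_cross a b b q" "\<not> arcs_cross a b p b" "\<not> arcs_cross a a p q" "\<not> arcs_cross a b p p"
  by (simp_all add: arcs_cross_def)

section \<open>Sign configurations of four, five and six points\<close>

locale four_points =
  fixes a b c d :: "real^3"
  assumes general_position4: "general_position {a, b, c, d}" and dist4: "distinct [a, b, c, d]"
begin

lemma nonzero4: "det3 a b c \<noteq> 0" "det3 a b d \<noteq> 0" "det3 a c d \<noteq> 0" "det3 b c d \<noteq> 0"
  using general_position4 dist4 by (auto simp: general_position_def)

text \<open>Rewriting with these brings every determinant to one argument order and turns
  \<open>< 0\<close> into the negation of \<open>0 <\<close>, so that only propositional atoms
  remain.\<close>

lemmas perms4 = det3_permute[of a b c, OF refl] det3_permute[of a b d, OF refl] det3_permute[of a c d, OF refl] det3_permute[of b c d, OF refl]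
  neg_less_0_iff_less neg_0_less_iff_less nonzero4[THEN neg_iff_not_pos]

end

locale five_points =
  fixes a b c d e :: "real^3"
  assumes general_position5: "general_position {a, b, c, d, e}" and dist5: "distinct [a, b, c, d, e]"
begin

lemma nonzero5: "det3 a b c \<noteq> 0" "det3 a b d \<noteq> 0" "det3 a b e \<noteq> 0" "det3 a c d \<noteq> 0" "det3 a c e \<noteq> 0"
    "det3 a d e \<noteq> 0" "det3 b c d \<noteq> 0" "det3 b c e \<noteq> 0" "det3 b d e \<noteq> 0" "det3 c d e \<noteq> 0"
  using general_position5 dist5 by (auto simp: general_position_def)

lemmas perms5 = det3_permute[of a b c, OF refl] det3_permute[of a b d, OF refl] det3_permute[of a b e, OF refl] det3_permute[of a c d, OF refl] det3_permute[of a c e, OF refl]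
  det3_permute[of a d e, OF refl] det3_permute[of b c d, OF refl] det3_permute[of b c e, OF refl] det3_permute[of b d e, OF refl] det3_permute[of c d e, OF refl]
  neg_less_0_iff_less neg_0_less_iff_less nonzero5[THEN neg_iff_not_pos]

text \<open>One three-term relation for each choice of the common vector among the five points.
  Together with nonvanishing they carry all the geometry into the propositional proofs.\<close>

lemma grassmann_pluecker_signs:
  "sign_relation (pos a b c) (pos a d e) (pos a b d) (pos a c e) (pos a b e) (pos a c d)"
  "sign_relation (pos a b c) (pos b d e) (pos a b d) (pos b c e) (pos a b e) (pos b c d)"
  "sign_relation (pos a b c) (pos c d e) (pos a c d) (pos b c e) (pos a c e) (pos b c d)"
  "sign_relation (pos a b d) (pos c d e) (pos a c d) (pos b d e) (pos a d e) (pos b c d)"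
  "sign_relation (pos a b e) (pos c d e) (pos a c e) (pos b d e) (pos a d e) (pos b c e)"
proof -
  have "det3 a b c * det3 a d e - det3 a b d * det3 a c e + det3 a b e * det3 a c d = 0"
    by (rule grassmann_pluecker)
  then show "sign_relation (pos a b c) (pos a d e) (pos a b d) (pos a c e) (pos a b e) (pos a c d)"
    by (rule sign_relation_of_sum) (rule nonzero5)+
  have "det3 a b c * det3 b d e - det3 a b d * det3 b c e + det3 a b e * det3 b c d = 0"
    using grassmann_pluecker[of b a c d e] unfolding det3_permute[of a b c, OF refl] det3_permute[of a b d, OF refl] det3_permute[of a b e, OF refl] by linarith
  then show "sign_relation (pos a b c) (pos b d e) (pos a b d) (pos b c e) (pos a b e) (pos b c d)"
    by (rule sign_relation_of_sum) (rule nonzero5)+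
  have "det3 a b c * det3 c d e - det3 a c d * det3 b c e + det3 a c e * det3 b c d = 0"
    using grassmann_pluecker[of c a b d e] unfolding det3_permute[of a b c, OF refl] det3_permute[of a c d, OF refl] det3_permute[of b c e, OF refl]
      det3_permute[of a c e, OF refl] det3_permute[of b c d, OF refl] by linarith
  then show "sign_relation (pos a b c) (pos c d e) (pos a c d) (pos b c e) (pos a c e) (pos b c d)"
    by (rule sign_relation_of_sum) (rule nonzero5)+
  have "det3 a b d * det3 c d e - det3 a c d * det3 b d e + det3 a d e * det3 b c d = 0"
    using grassmann_pluecker[of d a b c e] unfolding det3_permute[of a b d, OF refl] det3_permute[of c d e, OF refl] det3_permute[of a c d, OF refl]
      det3_permute[of b d e, OF refl] det3_permute[of a d e, OF refl] det3_permute[of b c d, OF refl] by linarith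
  then show "sign_relation (pos a b d) (pos c d e) (pos a c d) (pos b d e) (pos a d e) (pos b c d)"
    by (rule sign_relation_of_sum) (rule nonzero5)+
  have "det3 a b e * det3 c d e - det3 a c e * det3 b d e + det3 a d e * det3 b c e = 0"
    using grassmann_pluecker[of e a b c d] unfolding det3_permute[of a b e, OF refl] det3_permute[of c d e, OF refl] det3_permute[of a c e, OF refl]
      det3_permute[of b d e, OF refl] det3_permute[of a d e, OF refl] det3_permute[of b c e, OF refl] by linarith
  then show "sign_relation (pos a b e) (pos c d e) (pos a c e) (pos b d e) (pos a d e) (pos b c e)"
    by (rule sign_relation_of_sum) (rule nonzero5)+
qed

lemmas signs5 = grassmann_pluecker_signs[unfolded sign_relation_def]

text \<open>The arc \<open>d e\<close> crosses the boundary of the triangle \<open>a b c\<close> an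
  odd number of times exactly if it joins the inside to the outside.\<close>

lemma edge_triangle_parity:
  "even (of_bool (arcs_cross a b d e) + of_bool (arcs_cross b c d e) + of_bool (arcs_cross a c d e) + of_bool (in_cone a b c d) + of_bool (in_cone a b c e) :: nat)"
  unfolding arcs_cross_def in_cone_def even_add even_of_bool using signs5 by (simp only: perms5) satx

text \<open>The path \<open>e a d\<close> passes through the corner \<open>a\<close> of the
  triangle. Its crossings with the sides at \<open>a\<close> are replaced by whether the directions
  of \<open>b\<close> and \<open>c\<close> lie in the sector at \<open>a\<close> from
  \<open>d\<close> to \<open>e\<close>.\<close>

lemma corner_parity:
  "even (of_bool (arcs_cross b c a d) + of_bool (arcs_cross b c e a) + of_bool (in_cone a b c d) + of_bool (in_cone a b c e)
     + of_bool (ccw a d b e) + of_bool (ccw a d c e) :: nat)"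
  unfolding arcs_cross_def in_cone_def ccw_def even_add even_of_bool using signs5 by (simp only: perms5) satx

text \<open>The path \<open>e a b d\<close> runs along the side \<open>a b\<close> of the triangle,
  so a sector term appears at both \<open>a\<close> and \<open>b\<close>.\<close>

lemma edge_side_parity:
  "even (of_bool (arcs_cross a c b d) + of_bool (arcs_cross b c e a) + of_bool (in_cone a b c d) + of_bool (in_cone a b c e)
     + of_bool (ccw b d c a) + of_bool (ccw a b c e) :: nat)"
  unfolding arcs_cross_def in_cone_def ccw_def even_add even_of_bool using signs5 by (simp only: perms5) satx

end

locale six_points =
  fixes a b c d e f :: "real^3"
  assumes general_position6: "general_position {a, b, c, d, e, f}" and dist6: "distinct [a, b, c, d, e, f]"
begin

lemma fives:
  "five_points a b c d e" "five_points a b c d f" "five_points a b c e f"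
  "five_points a b d e f" "five_points a c d e f" "five_points b c d e f"
  using dist6 by (auto intro!: five_points.intro general_position_subset[OF general_position6])

lemmas signs6 = fives[THEN five_points.signs5(1)] fives[THEN five_points.signs5(2)]
  fives[THEN five_points.signs5(3)] fives[THEN five_points.signs5(4)] fives[THEN five_points.signs5(5)]

lemmas perms6 = five_points.perms5[OF fives(1)] five_points.perms5[OF fives(2)] five_points.perms5[OF fives(3)]
  five_points.perms5[OF fives(4)] five_points.perms5[OF fives(5)] five_points.perms5[OF fives(6)]

text \<open>The line \<open>c d\<close> cuts off from the triangle \<open>a b c\<close> a smaller
  triangle at \<open>b\<close>, which contains the chord \<open>b d\<close>. The arc
  \<open>e f\<close> cannot enter it through \<open>a b\<close> or \<open>b c\<close>, has no end
  inside it, and meets its third side at most once.\<close>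

lemma chord_uncrossed:
  assumes "in_cone a b c d" "\<not> arcs_cross a b e f" "\<not> arcs_cross b c e f"
    and "in_cone a b c e \<Longrightarrow> pos c d e \<noteq> pos c d b" "in_cone a b c f \<Longrightarrow> pos c d f \<noteq> pos c d b"
  shows "\<not> arcs_cross b d e f"
  using assms signs6 unfolding arcs_cross_def in_cone_def by (simp only: perms6) satx

end

context four_points
begin

lemma inside_triangle_signs:
  assumes "in_cone a b c d"
  shows "pos c d a \<noteq> pos c d b" "pos c d b = pos a b c" "ccw b c a d = (\<not> pos a b c)"
    "pos b c d = pos a b c" "pos d b c = pos a b c"
  using assms unfolding in_cone_def ccw_def by (simp_all only: perms4) satx+

text \<open>For deleting \<open>c\<close> from the path \<open>a b c d\<close> (first part) or
  \<open>b\<close> (second part): the new turn at the neighbour kept in the middle is its old turn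
  or the turn at the deleted vertex, unless the deleted triangle contains an end of the path or a
  crossing is lost.\<close>

lemma shortcut_turn: "in_cone b c d a \<or> pos a b d = pos a b c \<or> pos a b d = pos b c d \<or> arcs_cross a b c d"
  "in_cone a b c d \<or> pos a c d = pos b c d \<or> pos a c d = pos a b c \<or> arcs_cross c d a b"
  unfolding in_cone_def arcs_cross_def by (simp_all only: perms4) satx+
end

context five_points
begin

text \<open>This and the next lemma treat the edges that start at an end \<open>a\<close> or
  \<open>c\<close> of the triangle, where \<open>chord_uncrossed\<close> would degenerate.\<close>

lemma chord_uncrossed_left:
  assumes "in_cone a b c d" "\<not> arcs_cross b c a e" and "in_cone a b c e \<Longrightarrow> pos c d e \<noteq> pos c d b"
  shows "\<not> arcs_cross b d a e"
  using assms signs5 unfolding arcs_cross_def in_cone_def by (simp only: perms5) satx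

lemma chord_uncrossed_right:
  assumes "in_cone a b c d" "\<not> arcs_cross a b c e" and "in_cone a b c e \<Longrightarrow> pos c d e \<noteq> pos c d b"
  shows "\<not> arcs_cross b d c e"
  using assms signs5 unfolding arcs_cross_def in_cone_def by (simp only: perms5) satx

text \<open>On the side of \<open>b\<close>, the arc \<open>d e\<close> would run inside the
  triangle cut off by the line \<open>c d\<close>, and could leave it neither through
  \<open>a b\<close> or \<open>b c\<close> nor through that line again.\<close>

lemma tip_side:
  assumes "in_cone a b c d" "\<not> arcs_cross a b d e" "\<not> arcs_cross b c d e" and "in_cone a b c e \<Longrightarrow> pos c d e \<noteq> pos c d b"
  shows "pos c d e \<noteq> pos c d b"
  using assms signs5 unfolding arcs_cross_def in_cone_def by (simp only: perms5) satx

text \<open>Both neighbours \<open>d\<close>, \<open>e\<close> of \<open>c\<close> lie beyond the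
  line \<open>b c\<close> as seen from \<open>a\<close>, so the turn at \<open>c\<close> is decided
  by the cyclic order of \<open>a\<close>, \<open>e\<close>, \<open>d\<close> around
  \<open>c\<close>.\<close>

lemma tip_turn:
  assumes "pos b c d \<noteq> pos b c a" "pos b c e \<noteq> pos b c a" "ccw c a e d = (\<not> pos b c a)"
  shows "pos d c e = (\<not> pos b c a)"
  using assms signs5 unfolding ccw_def by (simp only: perms5) satx
end

section \<open>Crossing parity and sides of a closed polygon\<close>

text \<open>Polygons are \<open>n\<close>-periodic sequences, so that a cyclic relabelling is a shift and results can be stated at vertex \<open>0\<close>.\<close>

definition polygon :: "(nat \<Rightarrow> real^3) \<Rightarrow> nat \<Rightarrow> bool" where
  "polygon w n \<longleftrightarrow> (\<forall>i. w (i + n) = w i) \<and> inj_on w {..<n} \<and> general_position (range w)"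

lemma polygon_period: "polygon w n \<Longrightarrow> w (i + n) = w i"
  by (simp add: polygon_def)

lemma polygon_eq_iff:
  assumes "polygon w n" "i < n" "j < n"
  shows "w i = w j \<longleftrightarrow> i = j"
  using assms by (auto simp: polygon_def dest: inj_onD)

section \<open>Periodic sequences and cyclic shifts\<close>

lemma sum_shift_period:
  fixes g :: "nat \<Rightarrow> nat"
  assumes "\<And>i. g (i + n) = g i"
  shows "(\<Sum>i<n. g (i + l)) = (\<Sum>i<n. g i)"
proof (induction l)
  case (Suc l)
  have "(\<Sum>i<n. g (i + Suc l)) + g l = (\<Sum>i<Suc n. g (i + l))"
    by (subst sum.lessThan_Suc_shift) simp
  also have "\<dots> = (\<Sum>i<n. g (i + l)) + g l"
    using assms[of l] by (simp add: add.commute)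
  finally show ?case using Suc by simp
qed simp

lemma periodic_mod:
  fixes w :: "nat \<Rightarrow> 'a"
  assumes "\<And>i. w (i + n) = w i"
  shows "w (i mod n) = w i"
proof -
  have "w (j + q * n) = w j" for j q
  proof (induction q)
    case (Suc q)
    have "j + Suc q * n = (j + q * n) + n" by simp
    then show ?case using Suc assms by metis
  qed simp
  from this[of "i mod n" "i div n"] show ?thesis by simp
qed

lemma inj_on_shift:
  fixes w :: "nat \<Rightarrow> 'a"
  assumes per: "\<And>i. w (i + n) = w i" and inj: "inj_on w {..<n}"
  shows "inj_on (\<lambda>i. w (i + l)) {..<n}"
proof (rule inj_onI)
  fix i j assume ij: "i \<in> {..<n}" "j \<in> {..<n}" and e: "w (i + l) = w (j + l)"
  have "w ((i + l) mod n) = w ((j + l) mod n)"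
    using e periodic_mod[of w n, OF per] by simp
  then have "(i + l) mod n = (j + l) mod n"
    using inj ij by (auto dest!: inj_onD)
  then have "[i + l = j + l] (mod n)" by (simp add: cong_def)
  then have "[i = j] (mod n)" by (simp add: cong_add_rcancel_nat)
  then show "i = j" using ij by (simp add: cong_def)
qed

lemma polygon_shift:
  assumes "polygon w n"
  shows "polygon (\<lambda>i. w (i + l)) n"
proof -
  have "w (i + n + l) = w (i + l)" for i
    using polygon_period[OF assms, of "i + l"] by (simp add: add_ac)
  moreover have "general_position (range (\<lambda>i. w (i + l)))"
    using assms by (auto simp: polygon_def intro: general_position_subset)
  ultimately show ?thesis
    using inj_on_shift[of w n l] assms by (simp add: polygon_def)
qed

definition crossings :: "(nat \<Rightarrow> real^3) \<Rightarrow> nat \<Rightarrow> real^3 \<Rightarrow> real^3 \<Rightarrow> nat" where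
  "crossings k m y z = (\<Sum>i<m. of_bool (arcs_cross y z (k i) (k (Suc i))))"

text \<open>For simple \<open>k\<close>, whether \<open>y\<close> is on the left of the polygon, judged from vertex \<open>l\<close>: the parity of the crossings on the way to
  \<open>k l\<close>, corrected by whether the way arrives in the left sector at \<open>k l\<close>. Crossings with the two edges at \<open>k l\<close> are not counted.\<close>

definition side :: "(nat \<Rightarrow> real^3) \<Rightarrow> nat \<Rightarrow> nat \<Rightarrow> real^3 \<Rightarrow> bool" where
  "side k m l y \<longleftrightarrow> odd (crossings k m (k l) y + of_bool (ccw (k l) (k (Suc l)) y (k (l + m - 1))))"

lemma crossings_shift:
  assumes "polygon k m"
  shows "crossings (\<lambda>i. k (i + l)) m y z = crossings k m y z"
proof -
  have "k (i + m) = k i" "k (Suc (i + m)) = k (Suc i)" for i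
    using polygon_period[OF assms, of i] polygon_period[OF assms, of "Suc i"] by simp_all
  then show ?thesis
    using sum_shift_period[of "\<lambda>i. of_bool (arcs_cross y z (k i) (k (Suc i)))" m l]
    unfolding crossings_def by simp
qed

lemma crossings_commute: "crossings k m y z = crossings k m z y"
  unfolding crossings_def by (simp add: arcs_cross_commute(2)[of y z])

lemma crossings_eq_0: "(\<And>i. i < m \<Longrightarrow> \<not> arcs_cross y z (k i) (k (Suc i))) \<Longrightarrow> crossings k m y z = 0"
  by (simp add: crossings_def)

lemma telescope_parity:
  fixes s f :: "nat \<Rightarrow> nat"
  assumes "\<And>i. a \<le> i \<Longrightarrow> i < b \<Longrightarrow> even (s i + f i + f (Suc i))" "a \<le> b"
  shows "even (sum s {a..<b} + f a + f b)"
  using assms(2,1)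
proof (induction b rule: dec_induct)
  case (step b)
  have "even (sum s {a..<b} + f a + f b)" "even (s b + f b + f (Suc b))"
    using step by auto
  then show ?case using step(1) by (simp add: sum.atLeastLessThan_Suc) presburger
qed simp

lemma parity_combine:
  fixes t :: nat
  assumes "even (t + f + g)" "even (s + s' + f + g + c + c')" "a + b + a' = s + s' + t"
  shows "even (a + b + a' + c + c')"
  using assms by presburger

text \<open>Counts the crossings of the closed polygon with the triangle \<open>k 0\<close>,
  \<open>y\<close>, \<open>z\<close>. Edges away from \<open>k 0\<close> telescope by
  \<open>edge_triangle_parity\<close>; the two edges at \<open>k 0\<close> are covered by
  \<open>corner_parity\<close>.\<close>

lemma side_crossings_0:
  assumes P: "polygon k m" and m: "3 \<le> m" and gp: "general_position (insert y (insert z (range k)))"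
    and y: "y \<notin> range k" "z \<notin> range k" "y \<noteq> z"
  shows "side k m 0 y \<noteq> side k m 0 z \<longleftrightarrow> odd (crossings k m y z)"
proof -
  let ?s = "\<lambda>i. of_bool (arcs_cross (k 0) y (k i) (k (Suc i))) + of_bool (arcs_cross y z (k i) (k (Suc i)))
     + of_bool (arcs_cross (k 0) z (k i) (k (Suc i))) :: nat"
  let ?f = "\<lambda>i. of_bool (in_cone (k 0) y z (k i)) :: nat"
  have ne: "k i \<noteq> k j" if "i < m" "j < m" "i \<noteq> j" for i j
    using polygon_eq_iff[OF P] that by blast
  have km: "k m = k 0" using polygon_period[OF P, of 0] by simp
  have ny: "y \<noteq> k i" "z \<noteq> k i" for i using y by auto
  have "even (?s i + ?f i + ?f (Suc i))" if "1 \<le> i" "i < m - 1" for i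
  proof -
    have "five_points (k 0) y z (k i) (k (Suc i))"
      by (rule five_points.intro, rule general_position_subset[OF gp])
        (use that m y(3) ny ny[symmetric] in \<open>auto simp: ne\<close>)
    from five_points.edge_triangle_parity[OF this] show ?thesis by (simp add: add_ac)
  qed
  then have 1: "even (sum ?s {1..<m-1} + ?f 1 + ?f (m - 1))"
    by (rule telescope_parity) (use m in auto)
  have "five_points (k 0) y z (k 1) (k (m - 1))"
    by (rule five_points.intro, rule general_position_subset[OF gp])
      (use m y(3) ny ny[symmetric] in \<open>auto simp: ne\<close>)
  from five_points.corner_parity[OF this]
  have 2: "even (?s 0 + ?s (m - 1) + ?f 1 + ?f (m - 1) + of_bool (ccw (k 0) (k 1) y (k (m - 1)))
      + of_bool (ccw (k 0) (k 1) z (k (m - 1))))"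
    using m km by simp
  have "{..<m} = insert 0 (insert (m - 1) {1..<m - 1})" using m by auto
  then have "sum ?s {..<m} = ?s 0 + ?s (m - 1) + sum ?s {1..<m - 1}" using m by simp
  moreover have "sum ?s {..<m} = crossings k m (k 0) y + crossings k m y z + crossings k m (k 0) z"
    unfolding crossings_def by (simp add: sum.distrib)
  ultimately have "even (crossings k m (k 0) y + crossings k m y z + crossings k m (k 0) z
     + of_bool (ccw (k 0) (k 1) y (k (m - 1))) + of_bool (ccw (k 0) (k 1) z (k (m - 1))))"
    by (intro parity_combine[OF 1 2]) (simp only:)
  then show ?thesis unfolding side_def by (auto simp: even_add)
qed

text \<open>The same count for the triangle with corners \<open>k (m - 1)\<close>,
  \<open>k 0\<close>, \<open>y\<close>, one side of which is an edge of the polygon. The bound on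
  \<open>m\<close> makes the outer neighbours \<open>k 1\<close> and \<open>k (m - 2)\<close>
  distinct.\<close>

lemma side_edge_0:
  assumes P: "polygon k m" and m: "4 \<le> m" and gp: "general_position (insert y (range k))"
    and y: "y \<notin> range k" and free: "crossings k m (k (m - 1)) (k 0) = 0"
  shows "side k m (m - 1) y \<longleftrightarrow> side k m 0 y"
proof -
  let ?a = "k (m - 1)"
  let ?s = "\<lambda>i. of_bool (arcs_cross ?a (k 0) (k i) (k (Suc i))) + of_bool (arcs_cross (k 0) y (k i) (k (Suc i)))
     + of_bool (arcs_cross ?a y (k i) (k (Suc i))) :: nat"
  let ?f = "\<lambda>i. of_bool (in_cone ?a (k 0) y (k i)) :: nat"
  have ne: "k i \<noteq> k j" if "i < m" "j < m" "i \<noteq> j" for i j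
    using polygon_eq_iff[OF P] that by blast
  have km: "k m = k 0" using polygon_period[OF P, of 0] by simp
  have e: "Suc (m - 1) = m" "Suc (m - 2) = m - 1" using m by auto
  have ny: "y \<noteq> k i" for i using y by auto
  have "even (?s i + ?f i + ?f (Suc i))" if "1 \<le> i" "i < m - 2" for i
  proof -
    have "five_points ?a (k 0) y (k i) (k (Suc i))"
      by (rule five_points.intro, rule general_position_subset[OF gp])
        (use that m ny ny[symmetric] in \<open>auto simp: ne\<close>)
    from five_points.edge_triangle_parity[OF this] show ?thesis by (simp add: add_ac)
  qed
  then have 1: "even (sum ?s {1..<m-2} + ?f 1 + ?f (m - 2))"
    by (rule telescope_parity) (use m in auto)
  have "five_points ?a (k 0) y (k 1) (k (m - 2))"
    by (rule five_points.intro, rule general_position_subset[OF gp])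
      (use m ny ny[symmetric] in \<open>auto simp: ne\<close>)
  from five_points.edge_side_parity[OF this]
  have 2: "even (?s 0 + ?s (m - 2) + ?f 1 + ?f (m - 2) + of_bool (ccw (k 0) (k 1) y ?a)
      + of_bool (ccw ?a (k 0) y (k (m - 2))))"
    by (simp only: e km arcs_cross_same of_bool_eq add_0 add_0_right simp_thms One_nat_def)
  have "{..<m} = insert 0 (insert (m - 1) (insert (m - 2) {1..<m - 2}))"
    using m by (simp only: set_eq_iff insert_iff lessThan_iff atLeastLessThan_iff) presburger
  moreover have "m - 1 \<notin> insert (m - 2) {1..<m - 2}" "m - 2 \<notin> {1..<m - 2}" "0 \<notin> insert (m - 1) (insert (m - 2) {1..<m - 2})"
    using m by auto
  ultimately have "sum ?s {..<m} = ?s 0 + ?s (m - 2) + sum ?s {1..<m - 2} + ?s (m - 1)"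
    by (simp only: sum.insert finite_insert finite_atLeastLessThan simp_thms add_ac)
  moreover have "?s (m - 1) = 0" by (simp only: e km arcs_cross_same of_bool_eq add_0)
  moreover have "sum ?s {..<m} = crossings k m ?a (k 0) + crossings k m (k 0) y + crossings k m ?a y"
    unfolding crossings_def by (simp add: sum.distrib)
  ultimately have "even (crossings k m (k 0) y + crossings k m ?a y + crossings k m ?a (k 0)
     + of_bool (ccw (k 0) (k 1) y ?a) + of_bool (ccw ?a (k 0) y (k (m - 2))))"
    by (intro parity_combine[OF 1 2]) (simp only: add_ac add_0 add_0_right)
  then have *: "even (crossings k m (k 0) y + crossings k m ?a y
     + of_bool (ccw (k 0) (k 1) y ?a) + of_bool (ccw ?a (k 0) y (k (m - 2))))"
    unfolding free by simp
  have "k (m - 1 + m - 1) = k (m - 2)"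
    using polygon_period[OF P, of "m - 2"] m by (simp add: numeral_2_eq_2)
  then show ?thesis
    unfolding side_def e add_0 km using * by (auto simp: even_add)
qed

definition simple_polygon :: "(nat \<Rightarrow> real^3) \<Rightarrow> bool" where
  "simple_polygon k \<longleftrightarrow> (\<forall>i j. \<not> arcs_cross (k i) (k (Suc i)) (k j) (k (Suc j)))"

lemma side_shift:
  assumes "polygon k m" "0 < m"
  shows "side (\<lambda>i. k (i + l)) m j y = side k m (j + l) y"
proof -
  have "j + m - 1 + l = j + l + m - 1" using assms by simp
  then show ?thesis unfolding side_def crossings_shift[OF assms(1)] by simp
qed

lemma side_period:
  assumes "polygon k m" "0 < m"
  shows "side k m (l + m) y = side k m l y"
proof -
  have "k (l + m) = k l" "k (Suc (l + m)) = k (Suc l)" "k (l + m + m - 1) = k (l + m - 1)"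
    using polygon_period[OF assms(1), of l] polygon_period[OF assms(1), of "Suc l"]
      polygon_period[OF assms(1), of "l + m - 1"] assms(2) by (simp_all add: add.commute)
  then show ?thesis unfolding side_def by simp
qed

lemma range_shift:
  assumes "polygon k m" "0 < m"
  shows "range (\<lambda>i. k (i + l)) = range k"
proof -
  have "k i \<in> range (\<lambda>i. k (i + l))" for i
  proof -
    have "k (i + l * m) = k i"
    proof (induction l)
      case (Suc l)
      then show ?case using polygon_period[OF assms(1), of "i + l * m"] by (simp add: add_ac)
    qed simp
    moreover have "i + l * m = (i + l * m - l) + l"
      using assms(2) by (cases m) auto
    ultimately show ?thesis by (metis rangeI)
  qed
  then show ?thesis by auto
qed

lemma side_crossings:
  assumes "polygon k m" "3 \<le> m" "general_position (insert y (insert z (range k)))"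
    "y \<notin> range k" "z \<notin> range k" "y \<noteq> z"
  shows "side k m l y \<noteq> side k m l z \<longleftrightarrow> odd (crossings k m y z)"
  using side_crossings_0[of "\<lambda>i. k (i + l)" m y z] assms polygon_shift[OF assms(1), of l]
  by (simp add: range_shift side_shift crossings_shift)

lemma side_edge:
  assumes "polygon k m" "4 \<le> m" "general_position (insert y (range k))" "y \<notin> range k"
    "crossings k m (k l) (k (Suc l)) = 0"
  shows "side k m (Suc l) y = side k m l y"
proof -
  have "m - 1 + Suc l = m + l" "k (m + l) = k l"
    using assms(2) polygon_period[OF assms(1), of l] by (simp_all add: add.commute)
  then have "side k m (m + l) y = side k m (Suc l) y"
    using side_edge_0[of "\<lambda>i. k (i + Suc l)" m y] assms polygon_shift[OF assms(1), of "Suc l"]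
    by (simp add: range_shift[OF assms(1)] side_shift[OF assms(1)] crossings_shift[OF assms(1)] del: add_Suc_right)
  then show ?thesis using side_period[OF assms(1), of l y] assms(2) by (simp add: add.commute)
qed

lemma side_simple:
  assumes "polygon k m" "4 \<le> m" "general_position (insert y (range k))" "y \<notin> range k" "simple_polygon k"
  shows "side k m l y = side k m 0 y"
proof (induction l)
  case (Suc l)
  have "crossings k m (k l) (k (Suc l)) = 0"
    using assms(5) by (simp add: simple_polygon_def crossings_def)
  from side_edge[OF assms(1-4) this] show ?case using Suc by simp
qed simp

section \<open>Linear relations, functionals and generic points\<close>

lemma cramer:
  "det3 a b c *\<^sub>R x = det3 x b c *\<^sub>R a + det3 a x c *\<^sub>R b + det3 a b x *\<^sub>R c"
  by (simp add: vec_eq_iff forall_3 det3_expand) algebra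

text \<open>The coefficients of the linear relation between four vectors are their minors. The
  common value of the two sides is a point on the ray of the crossing.\<close>

lemma arcs_cross_imp_combination:
  assumes "arcs_cross a b p q"
  obtains \<alpha> \<beta> \<gamma> \<delta> :: real where "\<alpha> > 0" "\<beta> > 0" "\<gamma> > 0" "\<delta> > 0"
    "\<alpha> *\<^sub>R a + \<beta> *\<^sub>R b = \<gamma> *\<^sub>R p + \<delta> *\<^sub>R q"
proof -
  have "det3 b p q *\<^sub>R a + (- det3 a p q) *\<^sub>R b = (- det3 a b q) *\<^sub>R p + det3 a b p *\<^sub>R q"
    "(- det3 b p q) *\<^sub>R a + det3 a p q *\<^sub>R b = det3 a b q *\<^sub>R p + (- det3 a b p) *\<^sub>R q"
    by (simp_all add: vec_eq_iff forall_3 det3_expand) algebra+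
  with that[of "det3 b p q" "- det3 a p q" "- det3 a b q" "det3 a b p"]
    that[of "- det3 b p q" "det3 a p q" "det3 a b q" "- det3 a b p"]
  show ?thesis using assms unfolding arcs_cross_def by linarith
qed

lemma arcs_cross_inner_contradiction:
  assumes "arcs_cross a b p q" "v \<bullet> a \<le> 0" "v \<bullet> b < 0" "0 \<le> v \<bullet> p" "0 \<le> v \<bullet> q"
  shows False
proof -
  obtain \<alpha> \<beta> \<gamma> \<delta> :: real where "\<alpha> > 0" "\<beta> > 0" "\<gamma> > 0" "\<delta> > 0"
    and e: "\<alpha> *\<^sub>R a + \<beta> *\<^sub>R b = \<gamma> *\<^sub>R p + \<delta> *\<^sub>R q"
    using arcs_cross_imp_combination[OF assms(1)] .
  moreover have "\<alpha> * (v \<bullet> a) + \<beta> * (v \<bullet> b) = \<gamma> * (v \<bullet> p) + \<delta> * (v \<bullet> q)"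
    using arg_cong[OF e, of "\<lambda>x. v \<bullet> x"] by (simp add: inner_add_right)
  ultimately show False using assms
    by (smt (verit) mult_nonneg_nonneg mult_pos_neg mult_pos_pos mult_nonneg_nonpos)
qed

lemma avoid_planes:
  fixes N :: "(real^3) set"
  assumes "finite N" "0 \<notin> N" "open U" "U \<noteq> {}"
  shows "\<exists>x\<in>U. \<forall>n\<in>N. n \<bullet> x \<noteq> 0"
  using assms
proof (induction N arbitrary: U rule: finite_induct)
  case (insert n N)
  have "open (U \<inter> {x. n \<bullet> x \<noteq> 0})"
    by (intro open_Int open_Collect_neq continuous_on_inner continuous_on_const continuous_on_id insert.prems)
  moreover have "U \<inter> {x. n \<bullet> x \<noteq> 0} \<noteq> {}"
  proof -
    obtain x where x: "x \<in> U" using insert.prems(3) by auto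
    then obtain e where e: "0 < e" "ball x e \<subseteq> U"
      using insert.prems(2) open_contains_ball by metis
    show ?thesis
    proof (cases "n \<bullet> x = 0")
      case True
      have n: "n \<noteq> 0" using insert.prems by auto
      let ?y = "x + (e / (2 * norm n)) *\<^sub>R n"
      have "dist x ?y = e / 2" using n e by (simp add: dist_norm)
      then have "?y \<in> U" using e by auto
      moreover have "n \<bullet> ?y \<noteq> 0" using True n e by (simp add: inner_add_right)
      ultimately show ?thesis by blast
    qed (use x in auto)
  qed
  ultimately have "\<exists>x\<in>U \<inter> {x. n \<bullet> x \<noteq> 0}. \<forall>n\<in>N. n \<bullet> x \<noteq> 0"
    using insert.prems by (intro insert.IH) auto
  then show ?case by auto
qed auto

lemma inner_cross3_det3: "cross3 a b \<bullet> x = det3 x a b"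
  by (simp add: inner_commute[of "cross3 a b"] dot_cross_det det3_def)

lemma general_position_insertI:
  assumes "general_position S" "\<And>a b. a \<in> S \<Longrightarrow> b \<in> S \<Longrightarrow> a \<noteq> b \<Longrightarrow> det3 x a b \<noteq> 0"
  shows "general_position (insert x S)"
proof -
  have "det3 a x b \<noteq> 0" "det3 a b x \<noteq> 0" "det3 x a b \<noteq> 0" if "a \<in> S" "b \<in> S" "a \<noteq> b" for a b
    using assms(2)[OF that] det3_permute(1,4)[of x a b, OF refl] by simp_all
  then show ?thesis using assms(1) unfolding general_position_def by auto
qed

text \<open>The new point has to avoid the planes spanned by two points of \<open>S\<close>. A third
  point shows that the normals of these planes are nonzero, since a vanishing cross product would
  make a determinant vanish.\<close>

lemma general_position_extend:
  assumes S: "finite S" "general_position S" "3 \<le> card S" and U: "open U" "U \<noteq> {}"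
  obtains z where "z \<in> U" "z \<notin> S" "general_position (insert z S)"
proof -
  let ?N = "(\<lambda>(a, b). cross3 a b) ` {(a, b). a \<in> S \<and> b \<in> S \<and> a \<noteq> b}"
  have "{(a, b). a \<in> S \<and> b \<in> S \<and> a \<noteq> b} \<subseteq> S \<times> S" by auto
  then have "finite ?N" using S by (intro finite_imageI) (auto intro: finite_subset)
  moreover have "0 \<notin> ?N"
  proof
    assume "0 \<in> ?N"
    then obtain a b where ab: "a \<in> S" "b \<in> S" "a \<noteq> b" "cross3 a b = 0" by auto
    have "\<not> S \<subseteq> {a, b}"
      using card_mono[of "{a, b}" S] S ab card_2_iff by (auto simp: card_insert_if)
    then obtain c where c: "c \<in> S" "c \<noteq> a" "c \<noteq> b" by auto
    have "det3 c a b = 0" using ab(4) inner_cross3_det3[of a b c] by simp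
    then show False using S(2) ab c unfolding general_position_def by metis
  qed
  ultimately obtain z where z: "z \<in> U" "\<forall>n\<in>?N. n \<bullet> z \<noteq> 0"
    using avoid_planes U by meson
  then have d: "det3 z a b \<noteq> 0" if "a \<in> S" "b \<in> S" "a \<noteq> b" for a b
    using that by (auto simp: inner_cross3_det3)
  have "z \<notin> S"
  proof
    assume "z \<in> S"
    moreover have "\<not> S \<subseteq> {z}" using card_mono[of "{z}" S] S by auto
    ultimately obtain b where "b \<in> S" "b \<noteq> z" by auto
    then show False using d[of z b] \<open>z \<in> S\<close> by simp
  qed
  then show ?thesis using that z(1) general_position_insertI[OF S(2) d] by blast
qed

lemma polygon_finite_range:
  assumes "polygon k m" "0 < m"
  shows "range k = k ` {..<m}" "finite (range k)" "card (range k) = m"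
proof -
  have "k i = k (i mod m)" for i
    using periodic_mod[of k m i] polygon_period[OF assms(1)] by simp
  then show r: "range k = k ` {..<m}" using assms(2) by (force simp: image_iff)
  show "finite (range k)" unfolding r by simp
  show "card (range k) = m" unfolding r using assms by (simp add: polygon_def card_image)
qed

text \<open>Otherwise the path would reach a point \<open>z\<close> near \<open>- k 0\<close> without crossing \<open>k\<close>; but a functional \<open>h\<close> that is nonnegative on
  \<open>k\<close> and vanishes at a convex vertex \<open>k j\<close> shows that \<open>z\<close> is on the right at \<open>k j\<close>.\<close>

lemma trapped_path:
  fixes k y :: "nat \<Rightarrow> real^3"
  assumes P: "polygon k m" and m: "4 \<le> m" and simple: "simple_polygon k"
    and turn: "\<And>l. 1 \<le> l \<Longrightarrow> l \<le> m - 2 \<Longrightarrow> det3 (k (l - 1)) (k l) (k (Suc l)) > 0"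
    and f: "\<And>i. f \<bullet> k i > 0"
    and gp: "general_position (range k \<union> y ` {..r})" and dis: "\<And>i. i \<le> r \<Longrightarrow> y i \<notin> range k"
    and ydis: "\<And>i. i < r \<Longrightarrow> y i \<noteq> y (Suc i)"
    and free: "\<And>i. i < r \<Longrightarrow> crossings k m (y i) (y (Suc i)) = 0" "crossings k m (k 0) (y 0) = 0"
    and left: "ccw (k 0) (k 1) (y 0) (k (m - 1))"
    and i: "i \<le> r"
  shows "f \<bullet> y i > 0"
proof (rule ccontr)
  assume "\<not> f \<bullet> y i > 0"
  then have neg: "f \<bullet> y i \<le> 0" by simp
  \<comment> \<open>The plane through \<open>k 0\<close> and \<open>k (m - 1)\<close>, oriented so
    that \<open>k 1\<close> is on its positive side.\<close>
  define G where "G = (if det3 (k 1) (k 0) (k (m - 1)) > 0 then cross3 (k 0) (k (m - 1)) else - cross3 (k 0) (k (m - 1)))"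
  have G0: "G \<bullet> k 0 = 0" "G \<bullet> k (m - 1) = 0"
    by (simp_all add: G_def inner_cross3_det3)
  have "det3 (k 1) (k 0) (k (m - 1)) \<noteq> 0"
    using P m polygon_eq_iff[OF P, of 1 0] polygon_eq_iff[OF P, of 1 "m - 1"] polygon_eq_iff[OF P, of 0 "m - 1"]
    unfolding polygon_def general_position_def by auto
  then have G1: "G \<bullet> k 1 > 0"
    by (auto simp: G_def inner_cross3_det3)
  \<comment> \<open>The plane \<open>G = 0\<close> is tilted by means of \<open>f\<close> until it
    supports the polygon; the largest quotient \<open>M\<close> is the slope at which an inner
    vertex \<open>k j\<close> lies on the plane \<open>h = 0\<close>.\<close>
  define q where "q l = (G \<bullet> k l) / (f \<bullet> k l)" for l
  define M where "M = Max (q ` {1..m - 2})"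
  have fin: "finite (q ` {1..m - 2})" "q ` {1..m - 2} \<noteq> {}" using m by auto
  obtain j where j: "1 \<le> j" "j \<le> m - 2" "q j = M"
    using Max_in[OF fin] unfolding M_def by auto
  have q1: "q 1 > 0" using G1 f by (simp add: q_def)
  have M: "q l \<le> M" if "1 \<le> l" "l \<le> m - 2" for l
    using that Max_ge[OF fin(1)] unfolding M_def by auto
  have "q 1 \<le> M" using M[of 1] m by simp
  then have Mpos: "M > 0" using q1 by linarith
  define h where "h = M *\<^sub>R f - G"
  have hk: "h \<bullet> k l = M * (f \<bullet> k l) - G \<bullet> k l" for l
    by (simp add: h_def inner_diff_left)
  have h_nonneg: "0 \<le> h \<bullet> k l" for l
  proof -
    have *: "0 \<le> h \<bullet> k l" if "l < m" for l
    proof (cases "l = 0 \<or> l = m - 1")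
      case True
      then show ?thesis using G0 Mpos f[of l] by (auto simp: hk)
    next
      case False
      then have "q l \<le> M" using that by (intro M) auto
      then show ?thesis using f[of l] unfolding q_def hk by (simp add: pos_divide_le_eq)
    qed
    show ?thesis using *[of "l mod m"] periodic_mod[of k m l] polygon_period[OF P] m by simp
  qed
  have hj: "h \<bullet> k j = 0" using j(3) f[of j] unfolding hk q_def by (auto simp: field_simps)
  have h0: "h \<bullet> k 0 > 0" using G0 Mpos f[of 0] by (simp add: hk)
  \<comment> \<open>Both functionals are negative near the antipode of \<open>k 0\<close>, and a
    generic point \<open>z\<close> is taken there.\<close>
  let ?S = "range k \<union> y ` {..r}" and ?U = "{x. f \<bullet> x < 0} \<inter> {x. h \<bullet> x < 0}"
  have "open ?U" by (intro open_Int open_halfspace_lt)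
  moreover have "- k 0 \<in> ?U" using h0 f[of 0] by simp
  then have "?U \<noteq> {}" by blast
  moreover have "finite ?S" using polygon_finite_range[OF P] m by auto
  moreover have "3 \<le> card ?S"
    using card_mono[of ?S "range k"] polygon_finite_range[OF P] m \<open>finite ?S\<close> by auto
  ultimately obtain z where z: "z \<in> ?U" "z \<notin> ?S" "general_position (insert z ?S)"
    using general_position_extend[OF _ gp] by metis
  have sub: "general_position (insert a (range k))" "general_position (insert a (insert b (range k)))"
    if "a \<in> insert z ?S" "b \<in> insert z ?S" for a b
    using that by (auto intro!: general_position_subset[OF z(3)])
  have m3: "3 \<le> m" using m by simp
  have side_y: "side k m 0 (y l)" if "l \<le> r" for l
    using that
  proof (induction l)
    case 0
    then show ?case using left free(2) by (simp add: side_def)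
  next
    case (Suc l)
    have "\<not> (side k m 0 (y l) \<noteq> side k m 0 (y (Suc l)))"
      using side_crossings[OF P m3 sub(2), of "y l" "y (Suc l)" 0] dis[of l] dis[of "Suc l"] ydis[of l] free(1)[of l] Suc.prems
      by auto
    then show ?case using Suc by simp
  qed
  have zneg: "f \<bullet> z < 0" "h \<bullet> z < 0" using z(1) by auto
  \<comment> \<open>The arc from \<open>y i\<close> to \<open>z\<close> lies where \<open>f\<close>
    is not positive, whereas \<open>f\<close> is positive on the polygon.\<close>
  have "crossings k m (y i) z = 0"
    using arcs_cross_inner_contradiction[OF _ neg zneg(1) less_imp_le[OF f] less_imp_le[OF f]] by (intro crossings_eq_0) blast
  then have "side k m 0 z"
    using side_crossings[OF P m3 sub(2), of "y i" z 0] side_y[OF i] dis[of i] z(2) i by auto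
  then have "side k m j z"
    using side_simple[OF P m sub(1) _ simple] z(2) by auto
  moreover have "crossings k m (k j) z = 0"
    using arcs_cross_inner_contradiction[OF _ eq_refl[OF hj] zneg(2) h_nonneg h_nonneg] by (intro crossings_eq_0) blast
  ultimately have c: "ccw (k j) (k (Suc j)) z (k (j + m - 1))" unfolding side_def by auto
  have kj: "k (j + m - 1) = k (j - 1)" using polygon_period[OF P, of "j - 1"] j(1) by simp
  have t: "det3 (k (j - 1)) (k j) (k (Suc j)) > 0" using turn j by simp
  have *: "det3 (k j) (k (Suc j)) (k (j - 1)) > 0"
    using t det3_permute(4)[of "k (j - 1)" "k j" "k (Suc j)", OF refl] by simp
  have "det3 (k j) (k (j - 1)) (k (Suc j)) < 0"
    using t det3_permute(1)[of "k (j - 1)" "k j" "k (Suc j)", OF refl] by simp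
  then have "det3 (k j) (k (Suc j)) z > 0" "det3 (k j) z (k (j - 1)) > 0"
    using c unfolding ccw_def kj by auto
  \<comment> \<open>At a left turn the left sector consists of the positive combinations of the two
    neighbours modulo \<open>k j\<close>. As \<open>h\<close> vanishes at \<open>k j\<close> and is
    nonnegative at the neighbours, it cannot be negative at \<open>z\<close>.\<close>
  moreover have "det3 (k j) (k (Suc j)) (k (j - 1)) * (h \<bullet> z) =
     det3 (k j) z (k (j - 1)) * (h \<bullet> k (Suc j)) + det3 (k j) (k (Suc j)) z * (h \<bullet> k (j - 1))"
    using arg_cong[OF cramer[of "k j" "k (Suc j)" "k (j - 1)" z], of "\<lambda>x. h \<bullet> x"]
    by (simp add: inner_add_right hj)
  ultimately have "0 \<le> det3 (k j) (k (Suc j)) (k (j - 1)) * (h \<bullet> z)"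
    using h_nonneg by simp
  then show False using * z(1) by (simp add: zero_le_mult_iff)
qed

section \<open>Vertices inside the triangle at a vertex\<close>

definition prefix_polygon :: "(nat \<Rightarrow> real^3) \<Rightarrow> nat \<Rightarrow> nat \<Rightarrow> real^3" where
  "prefix_polygon w m i = w (i mod m)"

lemma prefix_polygon_simps:
  "i < m \<Longrightarrow> prefix_polygon w m i = w i" "prefix_polygon w m m = w 0"
  by (simp_all add: prefix_polygon_def)

lemma range_prefix_polygon: "0 < m \<Longrightarrow> range (prefix_polygon w m) = w ` {..<m}"
  by (auto simp: prefix_polygon_def image_iff) (metis mod_less)

lemma polygon_prefix_polygon:
  assumes "polygon w n" "0 < m" "m \<le> n"
  shows "polygon (prefix_polygon w m) m"
proof -
  have "inj_on (prefix_polygon w m) {..<m}"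
    using assms by (auto simp: inj_on_def prefix_polygon_simps polygon_eq_iff[OF assms(1)])
  moreover have "general_position (range (prefix_polygon w m))"
    unfolding range_prefix_polygon[OF assms(2)] using assms(1)
    by (auto simp: polygon_def intro: general_position_subset)
  ultimately show ?thesis by (simp add: polygon_def prefix_polygon_def)
qed

lemma crossings_prefix_eq_0:
  assumes "\<And>i. i < j \<Longrightarrow> \<not> arcs_cross y z (w i) (w (Suc i))" "\<not> arcs_cross y z (w j) (w 0)"
  shows "crossings (prefix_polygon w (Suc j)) (Suc j) y z = 0"
proof (rule crossings_eq_0)
  fix i assume "i < Suc j"
  then show "\<not> arcs_cross y z (prefix_polygon w (Suc j) i) (prefix_polygon w (Suc j) (Suc i))"
    using assms by (cases "i = j") (auto simp: prefix_polygon_simps)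
qed

text \<open>The vertex is the one seen from \<open>w 1\<close> at the smallest angle from \<open>w 0\<close>; the quotient \<open>q\<close> is monotone in this angle.\<close>

lemma inside_vertex_extremal:
  fixes w :: "nat \<Rightarrow> real^3"
  assumes P: "polygon w n" and J: "\<exists>j\<in>{2..n - 2}. in_cone (w (n - 1)) (w 0) (w 1) (w j)" and n: "4 \<le> n"
  obtains j where "2 \<le> j" "j \<le> n - 2" "in_cone (w (n - 1)) (w 0) (w 1) (w j)"
    "\<And>i. 2 \<le> i \<Longrightarrow> i \<le> n - 2 \<Longrightarrow> i \<noteq> j \<Longrightarrow> in_cone (w (n - 1)) (w 0) (w 1) (w i) \<Longrightarrow>
       pos (w 1) (w j) (w i) \<noteq> pos (w (n - 1)) (w 0) (w 1)"
proof -
  define b c d where "b = w (n - 1)" and "c = w 0" and "d = w 1"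
  define J where "J = {j\<in>{2..n - 2}. in_cone b c d (w j)}"
  define q where "q j = det3 (w j) c d / det3 b (w j) d" for j
  have fin: "finite (q ` J)" "q ` J \<noteq> {}" using J by (auto simp: J_def b_def c_def d_def)
  obtain j where j: "j \<in> J" "q j = Min (q ` J)" using Min_in[OF fin] by auto
  have min: "q j \<le> q i" if "i \<in> J" for i using that j(2) Min_le[OF fin(1)] by auto
  have main: "pos d (w j) (w i) \<noteq> pos b c d" if i: "i \<in> J" "i \<noteq> j" for i
  proof -
    have s: "in_cone b c d (w i)" "in_cone b c d (w j)" using i j by (auto simp: J_def)
    have "det3 (w j) c d = det3 c d (w j)" "det3 (w i) c d = det3 c d (w i)"
      "det3 b (w j) d = - det3 b d (w j)" "det3 b (w i) d = - det3 b d (w i)"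
      by (simp_all add: det3_expand)
    then have sg: "(det3 b c d > 0 \<and> det3 (w j) c d > 0 \<and> det3 b (w j) d > 0 \<and> det3 (w i) c d > 0 \<and> det3 b (w i) d > 0) \<or>
       (det3 b c d < 0 \<and> det3 (w j) c d < 0 \<and> det3 b (w j) d < 0 \<and> det3 (w i) c d < 0 \<and> det3 b (w i) d < 0)"
      using s unfolding in_cone_def by auto
    \<comment> \<open>This relation turns the comparison of the two quotients into the position of
      \<open>w i\<close> relative to the line from \<open>d\<close> to \<open>w j\<close>.\<close>
    have eq: "det3 b c d * det3 d (w j) (w i) = det3 (w j) c d * det3 b (w i) d - det3 b (w j) d * det3 (w i) c d"
      unfolding det3_expand by algebra
    have "det3 (w j) c d / det3 b (w j) d \<le> det3 (w i) c d / det3 b (w i) d"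
      using min[OF i(1)] by (simp add: q_def)
    then have "det3 (w j) c d * det3 b (w i) d \<le> det3 b (w j) d * det3 (w i) c d"
      using sg by (auto simp: divide_simps mult.commute)
    then have "det3 b c d * det3 d (w j) (w i) \<le> 0" using eq by simp
    moreover have "det3 d (w j) (w i) \<noteq> 0"
    proof -
      have "w 1 \<noteq> w j" "w j \<noteq> w i" "w 1 \<noteq> w i"
        using i j n polygon_eq_iff[OF P] by (auto simp: J_def)
      then show ?thesis using P unfolding polygon_def general_position_def d_def by blast
    qed
    ultimately show ?thesis using sg by (auto simp: mult_le_0_iff)
  qed
  show ?thesis
    by (rule that[of j]) (use j main in \<open>auto simp: J_def b_def c_def d_def\<close>)
qed

text \<open>The extremal choice of \<open>w j\<close> empties the part of the triangle through which
  the chord passes, so the chord is uncrossed. It closes \<open>w 0, ..., w j\<close> to a polygon,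
  and the remaining path stays on one side of it. That side, read off at \<open>w 0\<close> and
  transported to \<open>w j\<close>, gives the cyclic order at \<open>w j\<close> and with it the
  turn.\<close>

lemma inside_vertex_turn:
  assumes P: "polygon w n" and n: "4 \<le> n" and simple: "simple_polygon w"
    and J: "\<exists>j\<in>{2..n - 2}. in_cone (w (n - 1)) (w 0) (w 1) (w j)"
  obtains j where "2 \<le> j" "j \<le> n - 2" "in_cone (w (n - 1)) (w 0) (w 1) (w j)"
    "\<And>i. \<not> arcs_cross (w 0) (w j) (w i) (w (Suc i))"
    "pos (w (j - 1)) (w j) (w (Suc j)) \<noteq> pos (w (n - 1)) (w 0) (w 1)"
proof -
  define b c d where bcd: "b = w (n - 1)" "c = w 0" "d = w 1"
  obtain j where j: "2 \<le> j" "j \<le> n - 2" and p: "in_cone b c d (w j)"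
    and ext: "\<And>i. 2 \<le> i \<Longrightarrow> i \<le> n - 2 \<Longrightarrow> i \<noteq> j \<Longrightarrow> in_cone b c d (w i) \<Longrightarrow> pos d (w j) (w i) \<noteq> pos b c d"
    using inside_vertex_extremal[OF P J n] unfolding bcd by metis
  have ne: "w i \<noteq> w i'" if "i < n" "i' < n" "i \<noteq> i'" for i i'
    using polygon_eq_iff[OF P] that by blast
  have gp: "general_position (range w)" using P by (simp add: polygon_def)
  have wn: "w n = w 0" using polygon_period[OF P, of 0] by simp
  have sn: "Suc (n - Suc 0) = n" "Suc (n - 2) = n - Suc 0" using n by auto
  have nc: "\<not> arcs_cross (w i) (w (Suc i)) (w i') (w (Suc i'))" for i i'
    using simple by (simp add: simple_polygon_def)
  have bc: "\<not> arcs_cross b c (w i) (w (Suc i))" for i using nc[of "n - 1" i] by (simp add: bcd sn wn)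
  have cd: "\<not> arcs_cross c d (w i) (w (Suc i))" for i using nc[of 0 i] by (simp add: bcd)
  have four: "four_points b c d (w j)"
    by (rule four_points.intro, rule general_position_subset[OF gp]) (use j n in \<open>auto simp: bcd ne\<close>)
  note fs = four_points.inside_triangle_signs[OF four p]
  have five: "five_points b c d (w j) (w i)" if "2 \<le> i" "i \<le> n - 2" "i \<noteq> j" for i
    by (rule five_points.intro, rule general_position_subset[OF gp]) (use that j n in \<open>auto simp: bcd ne\<close>)
  have ext': "pos d (w j) (w i) \<noteq> pos d (w j) c" if "2 \<le> i" "i \<le> n - 2" "i \<noteq> j" "in_cone b c d (w i)" for i
    using ext[OF that] fs(2) by simp
  have free: "\<not> arcs_cross c (w j) (w i) (w (Suc i))" if i: "i < n" for i
  proof -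
    \<comment> \<open>Edges sharing an end with the chord, the further edges at \<open>w 1\<close>
      and at \<open>w (n - 1)\<close>, and the edges whose ends are distinct from all four
      points.\<close>
    consider "i = 0 \<or> i = n - 1 \<or> i = j \<or> Suc i = j" | "i = 1" "j \<noteq> 2" | "i = n - 2" "j \<noteq> n - 2"
      | "2 \<le> i" "i \<le> n - 3" "i \<noteq> j" "Suc i \<noteq> j"
      using i j n by force
    then show ?thesis
    proof cases
      case 1
      then show ?thesis by (auto simp: bcd sn wn)
    next
      case 2
      have "five_points b c d (w j) (w 2)" using five[of 2] 2 n by simp
      from five_points.chord_uncrossed_right[OF this p _ ext'] bc[of 1] show ?thesis
        using 2 n by (simp add: bcd numeral_2_eq_2)
    next
      case 3
      have "five_points b c d (w j) (w (n - 2))" using five[of "n - 2"] 3 n by simp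
      from five_points.chord_uncrossed_left[OF this p _ ext'] cd[of "n - 2"] show ?thesis
        using 3 n by (simp add: bcd sn arcs_cross_commute(3)[of _ _ "w (n - 2)" "w (n - Suc 0)"])
    next
      case 4
      have "six_points b c d (w j) (w i) (w (Suc i))"
        by (rule six_points.intro, rule general_position_subset[OF gp]) (use 4 j n in \<open>auto simp: bcd ne\<close>)
      from six_points.chord_uncrossed[OF this p bc cd ext' ext'] show ?thesis
        using 4 n by auto
    qed
  qed
  have freeA: "\<not> arcs_cross c (w j) (w i) (w (Suc i))" for i
  proof -
    have "w (i mod n) = w i" "w (Suc (i mod n)) = w (Suc i)"
      using periodic_mod[of w n i] periodic_mod[of "\<lambda>i. w (Suc i)" n i] polygon_period[OF P] polygon_period[OF P, of "Suc _"]
      by auto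
    then show ?thesis using free[of "i mod n"] n by simp
  qed
  have tip: "pos d (w j) (w (Suc j)) \<noteq> pos d (w j) c"
  proof (cases "Suc j = n - 1")
    case True
    then show ?thesis using fs(1) by (simp add: bcd)
  next
    case False
    then have r: "2 \<le> Suc j" "Suc j \<le> n - 2" "Suc j \<noteq> j" using j by auto
    show ?thesis using five_points.tip_side[OF five[OF r] p bc cd ext'] r by simp
  qed
  have "pos (w (j - 1)) (w j) (w (Suc j)) \<noteq> pos b c d"
  proof (cases "j = 2")
    case True
    then show ?thesis using tip fs(2) by (simp add: bcd)
  next
    case False
    then have j3: "3 \<le> j" using j by simp
    have q: "2 \<le> j - 1" "j - 1 \<le> n - 2" "j - 1 \<noteq> j" "Suc (j - 1) = j" using j3 j by auto
    have "\<not> arcs_cross b c (w j) (w (j - 1))" "\<not> arcs_cross c d (w j) (w (j - 1))"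
      using bc[of "j - 1"] cd[of "j - 1"] q(4) arcs_cross_commute(3)[of _ _ "w j" "w (j - 1)"] by auto
    from five_points.tip_side[OF five[OF q(1-3)] p this ext']
    have tipq: "pos d (w j) (w (j - 1)) \<noteq> pos d (w j) c" using q by simp
    let ?K = "prefix_polygon w (Suc j)" and ?m = "Suc j"
    have PK: "polygon ?K ?m" by (rule polygon_prefix_polygon[OF P]) (use j n in auto)
    have rK: "range ?K = w ` {..<Suc j}" by (rule range_prefix_polygon) simp
    have off: "w i \<notin> range ?K" if "j < i" "i < n" for i
      unfolding rK using that j n by (auto simp: ne)
    have gpK: "general_position (insert (w i) (range ?K))" "general_position (insert (w i) (insert (w i') (range ?K)))" for i i'
      by (auto simp: rK intro!: general_position_subset[OF gp])
    have m: "3 \<le> ?m" "4 \<le> ?m" using j3 by auto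
    have Ks: "?K 0 = c" "?K 1 = d" "?K (?m - 1) = w j" "?K ?m = c" "?K (?m - 2) = w (j - 1)"
      using j3 by (auto simp: prefix_polygon_simps bcd numeral_2_eq_2)
    \<comment> \<open>The remaining path is followed backward from \<open>w (n - 1)\<close>, whose
      side is read off from the sector at \<open>w 0\<close>; it crosses neither the initial part
      nor the chord.\<close>
    have "side ?K ?m 0 (w (n - 1 - i)) = (\<not> pos b c d)" if "i < n - 1 - j" for i
      using that
    proof (induction i)
      case 0
      have "crossings ?K ?m c b = 0"
      proof (rule crossings_prefix_eq_0)
        show "\<not> arcs_cross c b (w i) (w (Suc i))" for i using bc[of i] arcs_cross_commute(2)[of b c] by simp
        show "\<not> arcs_cross c b (w j) (w 0)" by (simp add: bcd)
      qed
      moreover have "?K (0 + ?m - 1) = w j" "?K (Suc 0) = d" using Ks by simp_all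
      ultimately have "side ?K ?m 0 b = (\<not> pos b c d)"
        using fs(3) unfolding side_def by (simp only: Ks) simp
      then show ?case by (simp add: bcd)
    next
      case (Suc i)
      let ?i = "n - 1 - Suc i"
      have e: "Suc ?i = n - 1 - i" using Suc.prems by simp
      have "crossings ?K ?m (w ?i) (w (Suc ?i)) = 0"
      proof (rule crossings_prefix_eq_0)
        show "\<not> arcs_cross (w ?i) (w (Suc ?i)) (w j) (w 0)"
          using freeA[of ?i] arcs_cross_commute(1)[of c "w j"] arcs_cross_commute(3)[of _ _ "w j" c] by (simp add: bcd)
      qed (rule nc)
      then have "side ?K ?m 0 (w ?i) = side ?K ?m 0 (w (Suc ?i))"
        using side_crossings_0[OF PK m(1) gpK(2) off off ne, of ?i "Suc ?i"] Suc.prems by auto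
      then show ?case using Suc e by simp
    qed
    from this[of "n - 2 - j"] have s0: "side ?K ?m 0 (w (Suc j)) = (\<not> pos b c d)"
      using j n by (simp add: Suc_diff_Suc numeral_2_eq_2)
    \<comment> \<open>The closing chord is uncrossed, so the base vertex of \<open>side\<close> can
      be moved along it from \<open>w 0\<close> to \<open>w j\<close>. There the side of the
      adjacent vertex \<open>w (Suc j)\<close> is just its sector.\<close>
    have "crossings ?K ?m (?K (?m - 1)) (?K 0) = 0"
      unfolding Ks
    proof (rule crossings_prefix_eq_0)
      show "\<not> arcs_cross (w j) c (w i) (w (Suc i))" for i using freeA[of i] arcs_cross_commute(2)[of c "w j"] by simp
      show "\<not> arcs_cross (w j) c (w j) (w 0)" by simp
    qed
    from side_edge_0[OF PK m(2) gpK(1) off this, of "Suc j"] s0 j n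
    have s1: "side ?K ?m (?m - 1) (w (Suc j)) = (\<not> pos b c d)" by auto
    have "crossings ?K ?m (w j) (w (Suc j)) = 0"
      by (rule crossings_prefix_eq_0) (use nc in auto)
    moreover have "?K (?m - 1 + ?m - 1) = ?K (?m - 2)"
      using polygon_period[OF PK, of "?m - 2"] j3 by (simp add: numeral_2_eq_2)
    moreover have "Suc (?m - 1) = ?m" by simp
    ultimately have ccw: "ccw (w j) c (w (Suc j)) (w (j - 1)) = (\<not> pos d (w j) c)"
      using s1 unfolding side_def by (simp only: Ks fs(2)) simp
    have "five_points c d (w j) (w (j - 1)) (w (Suc j))"
      by (rule five_points.intro, rule general_position_subset[OF gp]) (use j j3 n in \<open>auto simp: bcd ne\<close>)
    from five_points.tip_turn[OF this tipq tip ccw] show ?thesis using fs(2) by simp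
  qed
  then show ?thesis
    using that[of j] j p freeA unfolding bcd by blast
qed

section \<open>Removing a vertex\<close>

text \<open>Ordered pairs of edges are counted, so each crossing counts twice and this is the term
  \<open>2D\<close> of the bound.\<close>

definition crossing_count :: "(nat \<Rightarrow> real^3) \<Rightarrow> nat \<Rightarrow> nat" where
  "crossing_count w n = (\<Sum>i<n. \<Sum>j<n. of_bool (arcs_cross (w i) (w (Suc i)) (w j) (w (Suc j))))"

definition left_turn :: "(nat \<Rightarrow> real^3) \<Rightarrow> nat \<Rightarrow> nat \<Rightarrow> bool" where
  "left_turn w n i \<longleftrightarrow> pos (w (i + n - 1)) (w i) (w (Suc i))"

definition inflection_count :: "(nat \<Rightarrow> real^3) \<Rightarrow> nat \<Rightarrow> nat" where
  "inflection_count w n = (\<Sum>i<n. of_bool (left_turn w n i \<noteq> left_turn w n (Suc i)))"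

definition open_hemisphere :: "(nat \<Rightarrow> real^3) \<Rightarrow> bool" where
  "open_hemisphere w \<longleftrightarrow> (\<exists>v. \<forall>i. v \<bullet> w i > 0)"

definition ear :: "(nat \<Rightarrow> real^3) \<Rightarrow> nat \<Rightarrow> bool" where
  "ear w n \<longleftrightarrow> (\<forall>j\<in>{2..n - 2}. \<not> in_cone (w (n - 1)) (w 0) (w 1) (w j))"

lemma sum_ends:
  fixes g :: "nat \<Rightarrow> nat"
  shows "sum g {..<Suc (Suc N)} = g 0 + (\<Sum>i<N. g (Suc i)) + g (Suc N)"
  unfolding sum.lessThan_Suc[of g "Suc N"] sum.lessThan_Suc_shift[of g N] ..

text \<open>As the triangle at the ear is empty, an edge crossing the new side also crosses a
  deleted side. A crossing of a deleted side with an edge adjacent to the new side disappears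
  without replacement; this gain pays for new inflections in
  \<open>inflection_count_remove\<close>.\<close>

lemma crossing_count_remove:
  assumes P: "polygon w n" and n: "5 \<le> n" and ear: "ear w n"
  defines "w' \<equiv> prefix_polygon (\<lambda>i. w (Suc i)) (n - 1)"
  shows "crossing_count w' (n - 1)
    + 2 * of_bool (arcs_cross (w (n - 2)) (w (n - 1)) (w 0) (w 1)) + 2 * of_bool (arcs_cross (w 1) (w 2) (w (n - 1)) (w 0))
    \<le> crossing_count w n"
proof -
  obtain N where N: "n = Suc (Suc N)" "3 \<le> N" using n by (intro that[of "n - 2"]) auto
  have ne: "w i \<noteq> w i'" if "i < n" "i' < n" "i \<noteq> i'" for i i'
    using polygon_eq_iff[OF P] that by blast
  have gp: "general_position (range w)" using P by (simp add: polygon_def)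
  have wn: "w (Suc (Suc N)) = w 0" using polygon_period[OF P, of 0] N by simp
  define b c d where bcd: "b = w (Suc N)" "c = w 0" "d = w 1"
  define e where "e i j = (of_bool (arcs_cross (w i) (w (Suc i)) (w j) (w (Suc j))) :: nat)" for i j
  have esym: "e i j = e j i" for i j 
    unfolding e_def using arcs_cross_commute(1)[of "w i" "w (Suc i)" "w j" "w (Suc j)"] by (simp only:)
  have e0: "e 0 0 = 0" "e 0 (Suc N) = 0" "e (Suc N) 0 = 0" "e (Suc N) (Suc N) = 0"
    by (simp_all add: e_def wn)
  define G where "G i = (of_bool (arcs_cross (w i) (w (Suc i)) b d) :: nat)" for i
  have sw: "(\<Sum>i<N. e j (Suc i)) = (\<Sum>i<N. e (Suc i) j)" for j by (intro sum.cong refl esym)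
  \<comment> \<open>The indices \<open>0\<close> and \<open>Suc N\<close> are the two deleted edges;
    by symmetry their crossings are counted twice.\<close>
  have X: "crossing_count w n = (\<Sum>i<N. \<Sum>j<N. e (Suc i) (Suc j)) + 2 * (\<Sum>i<N. e (Suc i) 0 + e (Suc i) (Suc N))"
    unfolding crossing_count_def N(1) e_def[symmetric] sum_ends
    by (simp add: e0 sum.distrib sw[of 0] sw[of "Suc N"] mult_2)
  have w': "w' i = w (Suc i)" if "i < Suc N" for i
    using that by (simp add: w'_def N(1) prefix_polygon_simps)
  have w'N: "w' (Suc N) = d" "w' N = b" by (simp_all add: w'_def N(1) prefix_polygon_simps bcd)
  have "crossing_count w' (n - 1) = (\<Sum>i<N. \<Sum>j<N. e (Suc i) (Suc j)) + 2 * (\<Sum>i<N. G (Suc i))"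
  proof -
    have "(\<Sum>i<N. of_bool (arcs_cross (w' i) (w' (Suc i)) b d)) = (\<Sum>i<N. G (Suc i))"
      "(\<Sum>i<N. of_bool (arcs_cross b d (w' i) (w' (Suc i)))) = (\<Sum>i<N. G (Suc i))"
      using arcs_cross_commute(1)[of b d] by (auto intro!: sum.cong simp: w' G_def)
    moreover have "(\<Sum>i<N. \<Sum>j<N. of_bool (arcs_cross (w' i) (w' (Suc i)) (w' j) (w' (Suc j)))) = (\<Sum>i<N. \<Sum>j<N. e (Suc i) (Suc j))"
      by (auto intro!: sum.cong simp: w' e_def)
    ultimately show ?thesis
      unfolding crossing_count_def using N(1) by (simp add: sum.distrib w'N)
  qed
  moreover have "(\<Sum>i<N. G (Suc i)) + e N 0 + e 1 (Suc N) \<le> (\<Sum>i<N. e (Suc i) 0 + e (Suc i) (Suc N))"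
  proof -
    have "G (Suc i) + (if i = N - 1 then e N 0 else 0) + (if i = 0 then e 1 (Suc N) else 0)
        \<le> e (Suc i) 0 + e (Suc i) (Suc N)" if i: "i < N" for i
    proof -
      \<comment> \<open>At the two extreme indices the edge shares \<open>d\<close> or
        \<open>b\<close> with the new side and cannot cross it.\<close>
      consider "i = 0" | "i = N - 1" "i \<noteq> 0" | "0 < i" "i < N - 1" using i by linarith
      then show ?thesis
      proof cases
        case 1
        then show ?thesis using N by (simp add: G_def bcd)
      next
        case 2
        then have "Suc i = N" using N by simp
        then show ?thesis using 2 by (simp add: G_def bcd)
      next
        case 3
        have ni: "\<not> in_cone b c d (w (Suc i))" "\<not> in_cone b c d (w (Suc (Suc i)))"
          using ear 3 N unfolding ear_def bcd by auto
        have "five_points b c d (w (Suc i)) (w (Suc (Suc i)))"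
          by (rule five_points.intro, rule general_position_subset[OF gp]) (use 3 N in \<open>auto simp: bcd ne\<close>)
        from five_points.edge_triangle_parity[OF this] ni
        have "of_bool (arcs_cross b d (w (Suc i)) (w (Suc (Suc i)))) \<le> (of_bool (arcs_cross c d (w (Suc i)) (w (Suc (Suc i))))
           + of_bool (arcs_cross b c (w (Suc i)) (w (Suc (Suc i)))) :: nat)"
          by (auto simp: of_bool_def split: if_splits)
        then show ?thesis
          using 3 by (simp add: G_def e_def bcd wn arcs_cross_commute(1)[of "w (Suc i)"])
      qed
    qed
    then have "(\<Sum>i<N. G (Suc i) + (if i = N - 1 then e N 0 else 0) + (if i = 0 then e 1 (Suc N) else 0))
        \<le> (\<Sum>i<N. e (Suc i) 0 + e (Suc i) (Suc N))"
      by (intro sum_mono) auto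
    then show ?thesis using N by (simp add: sum.distrib)
  qed
  moreover have "e N 0 = of_bool (arcs_cross (w (n - 2)) (w (n - 1)) (w 0) (w 1))"
    "e 1 (Suc N) = of_bool (arcs_cross (w 1) (w 2) (w (n - 1)) (w 0))"
    by (simp_all add: e_def N(1) wn numeral_2_eq_2)
  ultimately show ?thesis unfolding X by linarith
qed

text \<open>Only the turns at the two neighbours change. By \<open>shortcut_turn\<close> each
  becomes its old value or the turn at the ear, which creates no sign change; in the exceptional
  case of a lost crossing at most two arise.\<close>

lemma inflection_count_remove:
  assumes P: "polygon w n" and n: "5 \<le> n" and ear: "ear w n"
  defines "w' \<equiv> prefix_polygon (\<lambda>i. w (Suc i)) (n - 1)"
  shows "inflection_count w' (n - 1) \<le> inflection_count w n
    + 2 * of_bool (arcs_cross (w (n - 2)) (w (n - 1)) (w 0) (w 1)) + 2 * of_bool (arcs_cross (w 1) (w 2) (w (n - 1)) (w 0))"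
proof -
  obtain M where M: "n = Suc (Suc (Suc (Suc M)))" "1 \<le> M"
    using n by (intro that[of "n - 4"]) auto
  have ne: "w i \<noteq> w i'" if "i < n" "i' < n" "i \<noteq> i'" for i i'
    using polygon_eq_iff[OF P] that by blast
  have gp: "general_position (range w)" using P by (simp add: polygon_def)
  have per: "w (Suc (i + (n - 1))) = w i" for i using polygon_period[OF P, of i] n by simp
  have wn: "w n = w 0" "w (Suc n) = w 1" using polygon_period[OF P, of 0] polygon_period[OF P, of 1] by simp_all
  define s s' where "s = left_turn w n" and "s' = left_turn w' (n - 1)"
  have w': "w' i = w (Suc i)" if "i < n - 1" for i
    using that by (simp add: w'_def prefix_polygon_simps)
  have pw': "w' (i + (n - 1)) = w' i" for i unfolding w'_def prefix_polygon_def by simp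
  have w'n: "w' (n - 1) = w 1" using pw'[of 0] w'[of 0] n by simp
  have sS: "s (Suc i) = pos (w i) (w (Suc i)) (w (Suc (Suc i)))" for i
    using polygon_period[OF P, of i] by (simp add: s_def left_turn_def)
  have s0: "s 0 = pos (w (n - 1)) (w 0) (w 1)" by (simp add: s_def left_turn_def)
  have s'S: "s' (Suc i) = pos (w' i) (w' (Suc i)) (w' (Suc (Suc i)))" for i
    using pw'[of i] n by (simp add: s'_def left_turn_def)
  have s'0: "s' 0 = pos (w' (n - 2)) (w' 0) (w' 1)"
    by (simp add: s'_def left_turn_def numeral_2_eq_2)
  have mid: "s' (Suc i) = s (Suc (Suc i))" if "i \<le> M" for i
    using that M by (simp add: s'S sS w')
  have a: "s' 0 = pos (w (n - 1)) (w 1) (w 2)"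
    using n unfolding s'0 by (simp add: w' numeral_2_eq_2 Suc_diff_Suc)
  have b: "s' (Suc (Suc M)) = pos (w (n - 2)) (w (n - 1)) (w 1)"
    using w'n M by (simp add: s'S w')
  have c: "s' (Suc (Suc (Suc M))) = s' 0"
    unfolding s'_def left_turn_def using M pw'[of 0] pw'[of 1] pw'[of "Suc (Suc M)"] by simp
  have d: "s (Suc (Suc (Suc M))) = pos (w (n - 2)) (w (n - 1)) (w 0)" using M wn by (simp add: sS)
  have e: "s n = s 0" unfolding s0 using sS[of "n - 1"] wn n by simp
  have f1: "four_points (w (n - 2)) (w (n - 1)) (w 0) (w 1)"
    by (rule four_points.intro, rule general_position_subset[OF gp]) (use n in \<open>auto simp: ne\<close>)
  have f2: "four_points (w (n - 1)) (w 0) (w 1) (w 2)"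
    by (rule four_points.intro, rule general_position_subset[OF gp]) (use n in \<open>auto simp: ne\<close>)
  have e1: "\<not> in_cone (w (n - 1)) (w 0) (w 1) (w (n - 2))" "\<not> in_cone (w (n - 1)) (w 0) (w 1) (w 2)"
    using ear n by (auto simp: ear_def)
  let ?A = "arcs_cross (w (n - 2)) (w (n - 1)) (w 0) (w 1)" and ?B = "arcs_cross (w 1) (w 2) (w (n - 1)) (w 0)"
  have A: "s' (Suc (Suc M)) = s (Suc (Suc (Suc M))) \<or> s' (Suc (Suc M)) = s 0 \<or> ?A"
    using four_points.shortcut_turn(1)[OF f1] e1 unfolding b d s0 by blast
  have B: "s' 0 = s 1 \<or> s' 0 = s 0 \<or> ?B"
    using four_points.shortcut_turn(2)[OF f2] e1 sS[of 0] unfolding a s0 by (auto simp: numeral_2_eq_2)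
  have I: "inflection_count w n = of_bool (s 0 \<noteq> s 1) + of_bool (s 1 \<noteq> s 2)
      + (\<Sum>i<M. of_bool (s (Suc (Suc i)) \<noteq> s (Suc (Suc (Suc i)))))
      + of_bool (s (Suc (Suc M)) \<noteq> s (Suc (Suc (Suc M)))) + of_bool (s (Suc (Suc (Suc M))) \<noteq> s 0)"
    unfolding inflection_count_def s_def[symmetric] unfolding M(1) sum_ends
    using e[unfolded M(1)] by (simp add: numeral_2_eq_2 sum.lessThan_Suc_shift del: sum.lessThan_Suc)
  have mids: "(\<Sum>i<M. of_bool (s' (Suc i) \<noteq> s' (Suc (Suc i)))) = (\<Sum>i<M. of_bool (s (Suc (Suc i)) \<noteq> s (Suc (Suc (Suc i)))) :: nat)"
    by (intro sum.cong) (auto simp: mid)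
  have "n - 1 = Suc (Suc (Suc M))" using M by simp
  then have I': "inflection_count w' (n - 1) = of_bool (s' 0 \<noteq> s 2)
      + (\<Sum>i<M. of_bool (s (Suc (Suc i)) \<noteq> s (Suc (Suc (Suc i)))))
      + of_bool (s (Suc (Suc M)) \<noteq> s' (Suc (Suc M))) + of_bool (s' (Suc (Suc M)) \<noteq> s' 0)"
    unfolding inflection_count_def s'_def[symmetric] 
    using c mids mid[of 0] mid[of M] by (simp only: sum_ends) (simp add: numeral_2_eq_2)
  show ?thesis unfolding I I' using A B by (auto simp: of_bool_def)
qed

section \<open>Hemispheres and essential vertices\<close>

text \<open>Gordan's alternative: otherwise a plane separates the origin from the compact convex
  hull of \<open>S\<close>.\<close>

lemma gordan:
  fixes S :: "(real^3) set"
  assumes S: "finite S" and no: "\<nexists>v. \<forall>x\<in>S. v \<bullet> x > 0"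
  obtains \<mu> where "\<And>x. x \<in> S \<Longrightarrow> 0 \<le> \<mu> x" "sum \<mu> S = 1" "(\<Sum>x\<in>S. \<mu> x *\<^sub>R x) = 0"
proof -
  have "0 \<in> convex hull S"
  proof (rule ccontr)
    assume "0 \<notin> convex hull S"
    moreover have "closed (convex hull S)"
      using S by (intro compact_imp_closed compact_convex_hull finite_imp_compact)
    ultimately obtain a b where "0 < b" "\<forall>x\<in>convex hull S. a \<bullet> x > b"
      using separating_hyperplane_closed_0[OF convex_convex_hull] by metis
    then have "\<forall>x\<in>S. a \<bullet> x > 0" using hull_inc[of _ S convex] by fastforce
    then show False using no by blast
  qed
  then show ?thesis using that unfolding convex_hull_finite[OF S] by blast
qed

lemma combination_inner:
  fixes v :: "real^3"
  assumes "(\<Sum>x\<in>S. \<mu> x *\<^sub>R x) = 0"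
  shows "(\<Sum>x\<in>S. \<mu> x * (v \<bullet> x)) = 0"
  using arg_cong[OF assms, of "\<lambda>x. v \<bullet> x"] by (simp add: inner_sum_right)

lemma combination_contradiction:
  fixes S :: "(real^3) set"
  assumes "finite S" "\<And>x. x \<in> S \<Longrightarrow> 0 \<le> \<mu> x" "(\<Sum>x\<in>S. \<mu> x *\<^sub>R x) = 0"
    "\<forall>x\<in>S - {a}. v \<bullet> x > 0" "\<mu> a = 0" "e \<in> S" "\<mu> e > 0"
  shows False
proof -
  have "0 \<le> \<mu> x * (v \<bullet> x)" if "x \<in> S" for x
    using assms(2,4,5) that by (cases "x = a") (auto simp: less_imp_le)
  moreover have "\<mu> e * (v \<bullet> e) > 0" using assms(4-7) by (cases "e = a") auto
  ultimately have "(\<Sum>x\<in>S. \<mu> x * (v \<bullet> x)) > 0"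
    using assms(1,6) by (intro sum_pos2) auto
  then show False using combination_inner[OF assms(3), of v] by simp
qed

text \<open>A nonnegative relation between the points must involve each of \<open>a, b, c, d\<close>. Adding a multiple of the relation between these
  four eliminates one of them, while \<open>e\<close> keeps the relation nontrivial.\<close>

lemma four_nonremovable_contradiction:
  fixes S :: "(real^3) set"
  assumes S: "finite S" "general_position S" and no: "\<nexists>v. \<forall>x\<in>S. v \<bullet> x > 0"
    and abcd: "a \<in> S" "b \<in> S" "c \<in> S" "d \<in> S" and dist: "distinct [a, b, c, d]"
    and e: "e \<in> S" "e \<notin> {a, b, c, d}"
    and nr: "\<And>x. x \<in> {a, b, c, d} \<Longrightarrow> \<exists>v. \<forall>y\<in>S - {x}. v \<bullet> y > 0"
  shows False
proof -
  obtain \<mu> where \<mu>: "\<And>x. x \<in> S \<Longrightarrow> 0 \<le> \<mu> x" "sum \<mu> S = 1" "(\<Sum>x\<in>S. \<mu> x *\<^sub>R x) = 0"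
    using gordan[OF S(1) no] by blast
  have nz: "det3 x y z \<noteq> 0" if "x \<in> {a, b, c, d}" "y \<in> {a, b, c, d}" "z \<in> {a, b, c, d}" "x \<noteq> y" "y \<noteq> z" "x \<noteq> z" for x y z
    using S(2) that abcd unfolding general_position_def by blast
  have \<mu>pos: "\<mu> x > 0" if "x \<in> {a, b, c, d}" for x
  proof (rule ccontr)
    assume "\<not> \<mu> x > 0"
    then have "\<mu> x = 0" using \<mu>(1) that abcd by force
    moreover obtain y where "y \<in> S" "\<mu> y > 0"
      using \<mu>(1,2) by (metis less_eq_real_def sum.neutral zero_neq_one)
    ultimately show False using combination_contradiction[OF S(1) \<mu>(1,3)] nr[OF that] by blast
  qed
  define \<Delta> where "\<Delta> = det3 a b c"
  have \<Delta>: "\<Delta> \<noteq> 0" unfolding \<Delta>_def by (rule nz) (use dist in auto)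
  \<comment> \<open>The relation that expresses \<open>e\<close> through \<open>a\<close>,
    \<open>b\<close>, \<open>c\<close>. A multiple \<open>\<tau>\<close> of it, small enough to keep
    the other coefficients nonnegative, makes the coefficient of \<open>e\<close> positive.\<close>
  define \<rho> where "\<rho> x = (if x = e then 1 else if x = a then - det3 e b c / \<Delta> else if x = b then - det3 a e c / \<Delta>
    else if x = c then - det3 a b e / \<Delta> else 0)" for x
  have \<rho>0: "(\<Sum>x\<in>S. \<rho> x *\<^sub>R x) = 0"
  proof -
    have "(\<Sum>x\<in>S. \<rho> x *\<^sub>R x) = (\<Sum>x\<in>{e, a, b, c}. \<rho> x *\<^sub>R x)"
      by (rule sum.mono_neutral_right) (use S abcd e in \<open>auto simp: \<rho>_def\<close>)
    also have "\<dots> = e - (det3 e b c / \<Delta>) *\<^sub>R a - (det3 a e c / \<Delta>) *\<^sub>R b - (det3 a b e / \<Delta>) *\<^sub>R c"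
      using dist e by (auto simp: \<rho>_def)
    also have "\<dots> = (1 / \<Delta>) *\<^sub>R (\<Delta> *\<^sub>R e - det3 e b c *\<^sub>R a - det3 a e c *\<^sub>R b - det3 a b e *\<^sub>R c)"
      using \<Delta> by (simp add: scaleR_diff_right)
    also have "\<dots> = 0" using cramer[of a b c e] by (simp add: \<Delta>_def)
    finally show ?thesis .
  qed
  define \<tau> where "\<tau> = Min (\<mu> ` {a, b, c}) / (1 + \<bar>\<rho> a\<bar> + \<bar>\<rho> b\<bar> + \<bar>\<rho> c\<bar>)"
  have Mpos: "Min (\<mu> ` {a, b, c}) > 0" using \<mu>pos by (subst Min_gr_iff) auto
  then have \<tau>: "\<tau> > 0" unfolding \<tau>_def by (intro divide_pos_pos) auto
  have \<tau>2: "0 \<le> \<mu> x + \<tau> * \<rho> x" if "x \<in> {a, b, c}" for x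
  proof -
    have "\<tau> * \<bar>\<rho> x\<bar> \<le> \<tau> * (1 + \<bar>\<rho> a\<bar> + \<bar>\<rho> b\<bar> + \<bar>\<rho> c\<bar>)"
      using that \<tau> by (intro mult_left_mono) auto
    also have "\<dots> = Min (\<mu> ` {a, b, c})" unfolding \<tau>_def by (simp add: add_pos_nonneg less_imp_neq[symmetric])
    also have "\<dots> \<le> \<mu> x" using that by (intro Min_le) auto
    finally show ?thesis using \<tau> abs_mult[of \<tau> "\<rho> x"] by linarith
  qed
  define \<nu> where "\<nu> x = \<mu> x + \<tau> * \<rho> x" for x
  have \<nu>: "0 \<le> \<nu> x" if "x \<in> S" for x
    using \<tau>2[of x] \<tau> \<mu>(1)[OF that] by (cases "x \<in> {a, b, c}") (auto simp: \<nu>_def \<rho>_def)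
  have \<nu>e: "\<nu> e > 0" using \<mu>(1)[OF e(1)] \<tau> by (simp add: \<nu>_def \<rho>_def)
  have \<nu>0: "(\<Sum>x\<in>S. \<nu> x *\<^sub>R x) = 0"
    using \<mu>(3) \<rho>0 by (simp add: \<nu>_def scaleR_add_left sum.distrib flip: scaleR_scaleR scaleR_sum_right)
  \<comment> \<open>This sign makes the coefficient of \<open>a\<close> in the relation
    \<open>l\<close> positive, so the minimum below is over a nonempty set.\<close>
  define s :: real where "s = (if det3 b c d > 0 then 1 else - 1)"
  define l where "l x = s * (if x = a then det3 b c d else if x = b then - det3 a c d
    else if x = c then det3 a b d else if x = d then - det3 a b c else 0)" for x
  have la: "l a > 0"
    using nz[of b c d] dist by (auto simp: l_def s_def)
  have l0: "(\<Sum>x\<in>S. l x *\<^sub>R x) = 0"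
  proof -
    have "(\<Sum>x\<in>S. l x *\<^sub>R x) = (\<Sum>x\<in>{a, b, c, d}. l x *\<^sub>R x)"
      by (rule sum.mono_neutral_right) (use S abcd in \<open>auto simp: l_def\<close>)
    also have "\<dots> = s *\<^sub>R (det3 b c d *\<^sub>R a - det3 a c d *\<^sub>R b + det3 a b d *\<^sub>R c - det3 a b c *\<^sub>R d)"
      using dist by (auto simp: l_def algebra_simps)
    also have "det3 b c d *\<^sub>R a - det3 a c d *\<^sub>R b + det3 a b d *\<^sub>R c - det3 a b c *\<^sub>R d = 0"
      by (simp add: vec_eq_iff forall_3 det3_expand) algebra
    finally show ?thesis by simp
  qed
  let ?L = "{x \<in> {a, b, c, d}. l x > 0}"
  have fin: "finite ((\<lambda>x. \<nu> x / l x) ` ?L)" "(\<lambda>x. \<nu> x / l x) ` ?L \<noteq> {}" using la by auto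
  \<comment> \<open>The largest multiple of \<open>l\<close> that can be subtracted with all
    coefficients nonnegative; the one of \<open>x0\<close> becomes zero.\<close>
  define t where "t = Min ((\<lambda>x. \<nu> x / l x) ` ?L)"
  obtain x0 where x0: "x0 \<in> ?L" "t = \<nu> x0 / l x0" using Min_in[OF fin] unfolding t_def by auto
  have t: "t \<le> \<nu> x / l x" if "x \<in> ?L" for x using Min_le[OF fin(1)] that unfolding t_def by auto
  have t0: "0 \<le> t" using x0 \<nu>[of x0] abcd by auto
  define \<nu>' where "\<nu>' x = \<nu> x - t * l x" for x
  have "0 \<le> \<nu>' x" if "x \<in> S" for x
  proof (cases "l x > 0")
    case True
    then have "x \<in> ?L" by (auto simp: l_def split: if_splits)
    then show ?thesis using t[of x] True by (simp add: \<nu>'_def field_simps)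
  next
    case False
    then show ?thesis using \<nu>[OF that] t0 by (simp add: \<nu>'_def) (smt (verit) mult_nonneg_nonpos)
  qed
  moreover have "\<nu>' e > 0" using \<nu>e e by (simp add: \<nu>'_def l_def)
  moreover have "\<nu>' x0 = 0" using x0 by (simp add: \<nu>'_def)
  moreover have "(\<Sum>x\<in>S. \<nu>' x *\<^sub>R x) = 0"
    using \<nu>0 l0 by (simp add: \<nu>'_def scaleR_diff_left sum_subtractf flip: scaleR_scaleR scaleR_sum_right)
  ultimately show False
    using combination_contradiction[OF S(1), of \<nu>' x0 _ e] nr[of x0] x0 e by blast
qed

lemma quadrilateral_inflections:
  assumes P: "polygon w 4" and no: "\<not> open_hemisphere w"
  shows "4 \<le> inflection_count w 4"
proof -
  have r: "range w = w ` {0, 1, 2, 3}"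
    using polygon_finite_range(1)[OF P] by (simp add: lessThan_nat_numeral lessThan_Suc insert_commute numeral_eq_Suc)
  have ne: "w i \<noteq> w j" if "i < 4" "j < 4" "i \<noteq> j" for i j
    using polygon_eq_iff[OF P] that by blast
  have gp: "general_position (range w)" using P by (simp add: polygon_def)
  define a b c d where abcd: "a = w 0" "b = w 1" "c = w 2" "d = w 3"
  have dist: "distinct [a, b, c, d]" by (simp add: abcd ne)
  have S: "range w = {a, b, c, d}" unfolding r abcd by simp
  have "\<nexists>v. \<forall>x\<in>{a, b, c, d}. v \<bullet> x > 0" using no unfolding open_hemisphere_def S[symmetric] by auto
  then obtain \<mu> where \<mu>: "\<And>x. x \<in> {a, b, c, d} \<Longrightarrow> 0 \<le> \<mu> x" "sum \<mu> {a, b, c, d} = 1" "(\<Sum>x\<in>{a, b, c, d}. \<mu> x *\<^sub>R x) = 0"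
    using gordan[of "{a, b, c, d}"] by blast
  have ge: "0 \<le> \<mu> a" "0 \<le> \<mu> b" "0 \<le> \<mu> c" "0 \<le> \<mu> d" using \<mu>(1) by auto
  have s1: "\<mu> a + \<mu> b + \<mu> c + \<mu> d = 1" using \<mu>(2) dist by simp
  have det: "\<mu> a * det3 a y z + \<mu> b * det3 b y z + \<mu> c * det3 c y z + \<mu> d * det3 d y z = 0" for y z
    using combination_inner[OF \<mu>(3), of "cross3 y z"] dist by (simp add: inner_cross3_det3)
  have four: "four_points a b c d"
    by (rule four_points.intro) (use gp S dist in auto)
  note n4 = four_points.nonzero4[OF four]
  note p4 = det3_permute[of a b c, OF refl] det3_permute[of a b d, OF refl] det3_permute[of a c d, OF refl] det3_permute[of b c d, OF refl]
  \<comment> \<open>Pairing with the cross product of two of the vectors eliminates them, so every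
    coefficient is tied to that of \<open>d\<close>; nonnegativity then fixes the signs of the
    minors.\<close>
  have e: "\<mu> a * det3 a b c = - (\<mu> d * det3 b c d)" "\<mu> c * det3 a b c = - (\<mu> d * det3 a b d)"
    "\<mu> b * det3 a b c = \<mu> d * det3 a c d"
    using det[of b c] det[of a b] det[of a c] by (simp_all add: p4)
  have d0: "\<mu> d > 0"
  proof (rule ccontr)
    assume "\<not> \<mu> d > 0"
    then have "\<mu> d = 0" using ge by simp
    then show False using e n4 s1 by simp
  qed
  have sg: "pos x y z = (\<not> pos a b c)" if "m * det3 a b c = - (\<mu> d * det3 x y z)" "0 \<le> m" "det3 x y z \<noteq> 0" for m x y z
  proof -
    have "\<mu> d * det3 x y z \<noteq> 0" using d0 that by simp
    then have "m > 0" using that by (cases "m = 0") auto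
    then show ?thesis using that d0 n4(1)
      by (smt (verit) mult_pos_pos mult_pos_neg)
  qed
  have "pos b c d = (\<not> pos a b c)" "pos a b d = (\<not> pos a b c)" "pos c a d = (\<not> pos a b c)"
    using sg[OF e(1)] sg[OF e(2)] sg[of "\<mu> b" c a d] e(3) ge n4 by (auto simp: p4)
  then have t: "pos b c d = (\<not> pos a b c)" "pos d a b = (\<not> pos a b c)" "pos c d a = pos a b c"
    using n4(3) by (auto simp: p4)
  have w4: "w 4 = a" "w 5 = b" "w 6 = c" "w 7 = d"
    using polygon_period[OF P, of 0] polygon_period[OF P, of 1] polygon_period[OF P, of 2] polygon_period[OF P, of 3]
    by (simp_all add: abcd)
  have "left_turn w 4 0 = pos d a b" "left_turn w 4 1 = pos a b c" "left_turn w 4 2 = pos b c d"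
    "left_turn w 4 3 = pos c d a" "left_turn w 4 4 = pos d a b"
    unfolding left_turn_def using w4 by (simp_all add: abcd numeral_eq_Suc)
  then show ?thesis using t unfolding inflection_count_def by (simp add: numeral_eq_Suc lessThan_Suc)
qed

section \<open>Inflections and ears of simple polygons\<close>

lemma left_turn_shift:
  assumes "0 < n"
  shows "left_turn (\<lambda>i. w (i + l)) n i = left_turn w n (i + l)"
proof -
  have "i + n - 1 + l = i + l + n - 1" using assms by simp
  then show ?thesis unfolding left_turn_def by simp
qed

lemma left_turn_period:
  assumes "polygon w n" "0 < n"
  shows "left_turn w n (i + n) = left_turn w n i"
proof -
  have "i + n + n - 1 = i + n - 1 + n" using assms(2) by simp
  then show ?thesis
    using polygon_period[OF assms(1), of "i + n - 1"] polygon_period[OF assms(1), of i]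
      polygon_period[OF assms(1), of "Suc i"]
    unfolding left_turn_def by simp
qed

lemma left_turn_Suc:
  assumes "polygon w n"
  shows "left_turn w n (Suc i) = pos (w i) (w (Suc i)) (w (Suc (Suc i)))"
  using polygon_period[OF assms, of i] by (simp add: left_turn_def)

lemma inflection_count_shift:
  assumes "polygon w n" "0 < n"
  shows "inflection_count (\<lambda>i. w (i + l)) n = inflection_count w n"
proof -
  have "left_turn w n (i + n) = left_turn w n i" "left_turn w n (Suc (i + n)) = left_turn w n (Suc i)" for i
    using left_turn_period[OF assms, of i] left_turn_period[OF assms, of "Suc i"] by simp_all
  then show ?thesis
    using sum_shift_period[of "\<lambda>i. of_bool (left_turn w n i \<noteq> left_turn w n (Suc i))" n l]
    unfolding inflection_count_def left_turn_shift[OF assms(2)] by simp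
qed

lemma crossing_count_shift:
  assumes "polygon w n"
  shows "crossing_count (\<lambda>i. w (i + l)) n = crossing_count w n"
proof -
  have per: "w (i + n) = w i" "w (Suc (i + n)) = w (Suc i)" for i
    using polygon_period[OF assms, of i] polygon_period[OF assms, of "Suc i"] by simp_all
  have "(\<Sum>j<n. of_bool (arcs_cross x y (w (j + l)) (w (Suc j + l)))) = (\<Sum>j<n. of_bool (arcs_cross x y (w j) (w (Suc j))) :: nat)" for x y
    using sum_shift_period[of "\<lambda>j. of_bool (arcs_cross x y (w j) (w (Suc j)))" n l] per by simp
  then show ?thesis
    using sum_shift_period[of "\<lambda>i. \<Sum>j<n. of_bool (arcs_cross (w i) (w (Suc i)) (w j) (w (Suc j)))" n l] per
    unfolding crossing_count_def by simp
qed

lemma open_hemisphere_range: "open_hemisphere w \<longleftrightarrow> (\<exists>v. \<forall>x\<in>range w. v \<bullet> x > 0)"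
  by (simp add: open_hemisphere_def)

lemma simple_polygon_shift: "simple_polygon w \<Longrightarrow> simple_polygon (\<lambda>i. w (i + l))"
  by (simp add: simple_polygon_def)

lemma crossing_count_simple: "simple_polygon w \<Longrightarrow> crossing_count w n = 0"
  by (simp add: simple_polygon_def crossing_count_def)

lemma inflection_count_card: "inflection_count w n = card {i. i < n \<and> left_turn w n i \<noteq> left_turn w n (Suc i)}"
  unfolding inflection_count_def by (simp add: Int_def conj_commute)

lemma turn_change:
  assumes "a < b" "P a \<noteq> P b"
  shows "\<exists>i. a \<le> i \<and> i < b \<and> P i \<noteq> P (Suc i)"
  using assms
proof (induction b rule: less_induct)
  case (less b)
  then obtain b' where b': "b = Suc b'" "a \<le> b'" by (cases b) auto
  show ?case
  proof (cases "P b' = P b")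
    case True
    then have "a < b'" using b' less.prems by (cases "a = b'") auto
    then obtain i where "a \<le> i" "i < b'" "P i \<noteq> P (Suc i)"
      using less.IH[of b'] True b' less.prems by auto
    then show ?thesis using b' by (intro exI[of _ i]) auto
  qed (use b' in auto)
qed

section \<open>The antipodal map, which exchanges left and right turns\<close>

lemma det3_uminus: "det3 (- a) (- b) (- c) = - det3 a b c"
  by (simp add: det3_expand)

lemma arcs_cross_uminus: "arcs_cross (- a) (- b) (- p) (- q) = arcs_cross a b p q"
  unfolding arcs_cross_def det3_uminus by auto

lemma in_cone_uminus: "in_cone (- a) (- b) (- c) (- x) = in_cone a b c x"
  unfolding in_cone_def det3_uminus by auto

lemma polygon_uminus: "polygon w n \<Longrightarrow> polygon (\<lambda>i. - w i) n"
  unfolding polygon_def general_position_def by (auto simp: inj_on_def det3_uminus)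

lemma polygon_det_nonzero:
  assumes "polygon w n" "3 \<le> n"
  shows "det3 (w i) (w (Suc i)) (w (Suc (Suc i))) \<noteq> 0"
proof -
  have "polygon (\<lambda>j. w (j + i)) n" by (rule polygon_shift[OF assms(1)])
  then have "w (0 + i) \<noteq> w (1 + i)" "w (0 + i) \<noteq> w (2 + i)" "w (1 + i) \<noteq> w (2 + i)"
    using polygon_eq_iff[of "\<lambda>j. w (j + i)" n 0 1] polygon_eq_iff[of "\<lambda>j. w (j + i)" n 0 2]
      polygon_eq_iff[of "\<lambda>j. w (j + i)" n 1 2] assms(2) by auto
  then show ?thesis using assms(1) by (auto simp: polygon_def general_position_def numeral_2_eq_2)
qed

lemma left_turn_uminus:
  assumes "polygon w n" "3 \<le> n"
  shows "left_turn (\<lambda>i. - w i) n i = (\<not> left_turn w n i)"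
proof -
  obtain i' where i': "left_turn w n i = left_turn w n (Suc i')"
      "left_turn (\<lambda>i. - w i) n i = left_turn (\<lambda>i. - w i) n (Suc i')"
    using left_turn_period[OF assms(1), of i] left_turn_period[OF polygon_uminus[OF assms(1)], of i] assms(2)
      not0_implies_Suc[of "i + n"] by auto
  show ?thesis
    using polygon_det_nonzero[OF assms, of i']
    unfolding i' left_turn_Suc[OF assms(1)] left_turn_Suc[OF polygon_uminus[OF assms(1)]] det3_uminus by auto
qed

lemma open_hemisphere_uminus: "open_hemisphere (\<lambda>i. - w i) = open_hemisphere w"
proof -
  have "(\<forall>i. (- v) \<bullet> - w i > 0) = (\<forall>i. v \<bullet> w i > 0)" for v by simp
  then show ?thesis unfolding open_hemisphere_def by (metis minus_minus)
qed

text \<open>Only the turns at \<open>0\<close> and \<open>m - 1\<close> can deviate, and these two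
  consecutive vertices belong to three pairs of neighbours.\<close>

lemma few_inflections:
  assumes P: "polygon k m" and m: "4 \<le> m"
    and turn: "\<And>l. 1 \<le> l \<Longrightarrow> l \<le> m - 2 \<Longrightarrow> left_turn k m l"
  shows "inflection_count k m \<le> 3"
proof -
  have "{i. i < m \<and> left_turn k m i \<noteq> left_turn k m (Suc i)} \<subseteq> {0, m - 2, m - 1}"
  proof
    fix i assume i: "i \<in> {i. i < m \<and> left_turn k m i \<noteq> left_turn k m (Suc i)}"
    have "\<not> (1 \<le> i \<and> Suc i \<le> m - 2)" using turn[of i] turn[of "Suc i"] i by auto
    then show "i \<in> {0, m - 2, m - 1}" using i by auto
  qed
  then have "card {i. i < m \<and> left_turn k m i \<noteq> left_turn k m (Suc i)} \<le> card {0, m - 2, m - 1}"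
    by (intro card_mono) auto
  also have "\<dots> \<le> 3" by (simp add: card_insert_if)
  finally show ?thesis by (simp add: inflection_count_card)
qed

text \<open>A predicate of \<open>n\<close> alone, to serve as induction hypothesis. Excluding only
  open hemispheres makes the statement stronger than with closed ones.\<close>

definition crossings_inflections_bound :: "nat \<Rightarrow> bool" where
  "crossings_inflections_bound n \<longleftrightarrow> (\<forall>w. polygon w n \<longrightarrow> \<not> open_hemisphere w \<longrightarrow> 4 \<le> crossing_count w n + inflection_count w n)"

lemma convex_part_in_hemisphere:
  assumes "crossings_inflections_bound m" "polygon k m" "4 \<le> m" "simple_polygon k"
    and turn: "\<And>l. 1 \<le> l \<Longrightarrow> l \<le> m - 2 \<Longrightarrow> left_turn k m l"
  shows "open_hemisphere k"
proof (rule ccontr)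
  assume "\<not> open_hemisphere k"
  then have "4 \<le> crossing_count k m + inflection_count k m"
    using assms(1,2) unfolding crossings_inflections_bound_def by blast
  then show False
    using few_inflections[OF assms(2,3) turn] crossing_count_simple[OF assms(4), of m] by simp
qed

text \<open>The turns alternate along \<open>0\<close>, \<open>1\<close>, \<open>l\<close>,
  \<open>j\<close>, \<open>n\<close>, so each of the four gaps contains a sign change.\<close>

lemma four_inflections:
  assumes "polygon w n" "l < j" "j < n" "1 < l" "left_turn w n 0 = left_turn w n l"
    "left_turn w n 1 \<noteq> left_turn w n 0" "left_turn w n j \<noteq> left_turn w n 0"
  shows "4 \<le> inflection_count w n"
proof -
  let ?P = "left_turn w n"
  have n: "?P n = ?P 0" using left_turn_period[OF assms(1), of 0] assms by simp
  obtain i2 where i2: "1 \<le> i2" "i2 < l" "?P i2 \<noteq> ?P (Suc i2)" using turn_change[of 1 l ?P] assms by auto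
  obtain i3 where i3: "l \<le> i3" "i3 < j" "?P i3 \<noteq> ?P (Suc i3)" using turn_change[of l j ?P] assms by auto
  obtain i4 where i4: "j \<le> i4" "i4 < n" "?P i4 \<noteq> ?P (Suc i4)" using turn_change[of j n ?P] assms n by auto
  have "card {0, i2, i3, i4} = 4" using i2 i3 i4 by auto
  moreover have "card {0, i2, i3, i4} \<le> inflection_count w n"
    unfolding inflection_count_card by (rule card_mono) (use assms i2 i3 i4 in auto)
  ultimately show ?thesis by simp
qed

text \<open>The case of the second end of a change from right to left... seen from its first vertex
  \<open>0\<close>; the antipodal map gives the opposite change and \<open>reversed\<close> the
  other end.\<close>

lemma inflection_ear_right:
  assumes IH: "\<And>m. 4 \<le> m \<Longrightarrow> m < n \<Longrightarrow> crossings_inflections_bound m" and P: "polygon w n" and n: "5 \<le> n"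
    and simple: "simple_polygon w" and I: "inflection_count w n < 4" and no: "\<not> open_hemisphere w"
    and turn: "\<not> left_turn w n 0" "left_turn w n 1"
  shows "ear w n"
proof (rule ccontr)
  assume "\<not> ear w n"
  then have "\<exists>j\<in>{2..n - 2}. in_cone (w (n - 1)) (w 0) (w 1) (w j)" by (auto simp: ear_def)
  from inside_vertex_turn[OF P _ simple this] n obtain j where j: "2 \<le> j" "j \<le> n - 2"
    and p: "in_cone (w (n - 1)) (w 0) (w 1) (w j)" and free: "\<And>i. \<not> arcs_cross (w 0) (w j) (w i) (w (Suc i))"
    and tj: "pos (w (j - 1)) (w j) (w (Suc j)) \<noteq> pos (w (n - 1)) (w 0) (w 1)"
    by auto
  define b c d where bcd: "b = w (n - 1)" "c = w 0" "d = w 1"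
  have ne: "w i \<noteq> w i'" if "i < n" "i' < n" "i \<noteq> i'" for i i'
    using polygon_eq_iff[OF P] that by blast
  have gp: "general_position (range w)" using P by (simp add: polygon_def)
  have wn: "w n = w 0" using polygon_period[OF P, of 0] by simp
  have nc: "\<not> arcs_cross (w i) (w (Suc i)) (w i') (w (Suc i'))" for i i'
    using simple by (simp add: simple_polygon_def)
  have four: "four_points b c d (w j)"
    by (rule four_points.intro, rule general_position_subset[OF gp]) (use j n in \<open>auto simp: bcd ne\<close>)
  note fs = four_points.inside_triangle_signs[OF four p[folded bcd]]
  have np: "\<not> pos b c d" using turn(1) by (simp add: left_turn_def bcd)
  have lt: "left_turn w n (Suc i) = pos (w i) (w (Suc i)) (w (Suc (Suc i)))" for i
    by (rule left_turn_Suc[OF P])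
  have ltj: "left_turn w n j" using tj np lt[of "j - 1"] j by (simp add: bcd)
  \<comment> \<open>A right turn between the left turns at \<open>1\<close> and \<open>j\<close>
    would produce the alternation of \<open>four_inflections\<close>.\<close>
  have all: "left_turn w n l" if "1 \<le> l" "l \<le> j" for l
  proof (rule ccontr)
    assume "\<not> left_turn w n l"
    then have "4 \<le> inflection_count w n"
      using that turn ltj j n by (intro four_inflections[OF P, of l j]) (auto simp: nat_less_le)
    then show False using I by simp
  qed
  \<comment> \<open>A vertex \<open>w 2\<close> inside the triangle would force the turn at
    \<open>w 1\<close> to agree with the one at \<open>w 0\<close>.\<close>
  have "j \<noteq> 2"
    using lt[of 0] turn(2) fs(4) np by (auto simp: bcd numeral_2_eq_2)
  then have j3: "3 \<le> j" using j by simp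
  let ?K = "prefix_polygon w (Suc j)" and ?m = "Suc j"
  have PK: "polygon ?K ?m" by (rule polygon_prefix_polygon[OF P]) (use j n in auto)
  have rK: "range ?K = w ` {..<Suc j}" by (rule range_prefix_polygon) simp
  have m: "4 \<le> ?m" "?m < n" using j3 j n by auto
  have Ki: "?K i = w i" if "i \<le> j" for i using that by (simp add: prefix_polygon_simps)
  have Kedge: "?K i = w i' \<and> ?K (Suc i) = w (Suc i') \<or> ?K i = w j \<and> ?K (Suc i) = w 0" if "i' = i mod ?m" for i i'
  proof -
    have "Suc i mod ?m = (if Suc (i mod ?m) = ?m then 0 else Suc (i mod ?m))" by (rule mod_Suc)
    then show ?thesis using that by (auto simp: prefix_polygon_def)
  qed
  have free2: "\<not> arcs_cross (w j) (w 0) (w i) (w (Suc i))" "\<not> arcs_cross (w i) (w (Suc i)) (w j) (w 0)" for i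
    using free[of i] arcs_cross_commute(2)[of "w 0" "w j"] arcs_cross_commute(1)[of "w j" "w 0"] by auto
  have sK: "simple_polygon ?K"
    unfolding simple_polygon_def using Kedge nc free2 by (metis arcs_cross_same(1))
  have ltK: "left_turn ?K ?m l" if l: "1 \<le> l" "l \<le> ?m - 2" for l
  proof -
    have "left_turn ?K ?m (Suc (l - 1)) = left_turn w n (Suc (l - 1))"
      unfolding left_turn_Suc[OF PK] lt using l by (simp add: Ki)
    then show ?thesis using all[of l] l by simp
  qed
  have "open_hemisphere ?K"
    by (rule convex_part_in_hemisphere[OF IH PK m(1) sK ltK]) (use m in auto)
  then obtain f where f: "\<And>i. f \<bullet> ?K i > 0" unfolding open_hemisphere_def by blast
  \<comment> \<open>The remaining vertices in reverse order: the path starts at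
    \<open>w (n - 1)\<close>, the neighbour of \<open>w 0\<close> in the left sector of the closed
    part.\<close>
  define y where "y i = w (n - 1 - i)" for i
  have path: "f \<bullet> y i > 0" if i: "i \<le> n - 2 - j" for i
  proof (rule trapped_path[OF PK m(1) sK _ f _ _ _ _ _ _ i])
    fix l assume l: "1 \<le> l" "l \<le> ?m - 2"
    then have "left_turn ?K ?m (Suc (l - 1))" using ltK by simp
    then show "det3 (?K (l - 1)) (?K l) (?K (Suc l)) > 0" using l unfolding left_turn_Suc[OF PK] by simp
  next
    show "general_position (range ?K \<union> y ` {..n - 2 - j})"
      by (rule general_position_subset[OF gp]) (auto simp: rK y_def)
  next
    fix i assume "i \<le> n - 2 - j"
    then show "y i \<notin> range ?K" unfolding rK y_def using j n by (auto simp: ne)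
  next
    fix i assume i: "i < n - 2 - j"
    then show "y i \<noteq> y (Suc i)" unfolding y_def using j n by (auto simp: ne)
    have "Suc (n - 1 - Suc i) = n - 1 - i" using i by simp
    then have yy: "y i = w (Suc (n - 1 - Suc i))" "y (Suc i) = w (n - 1 - Suc i)" by (simp_all add: y_def)
    show "crossings ?K ?m (y i) (y (Suc i)) = 0"
      unfolding crossings_commute[of _ _ "y i"] unfolding yy
      by (rule crossings_prefix_eq_0) (use nc free2 in auto)
  next
    have e: "\<not> arcs_cross (w 0) (w (n - 1)) (w i) (w (Suc i))" for i
      using nc[of "n - 1" i] arcs_cross_commute(2)[of "w (n - 1)" "w 0"] wn n by simp
    show "crossings ?K ?m (?K 0) (y 0) = 0"
      using e by (simp add: Ki y_def crossings_prefix_eq_0)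
  next
    show "ccw (?K 0) (?K 1) (y 0) (?K (?m - 1))"
      using fs(3) np j by (simp add: Ki y_def bcd)
  qed
  have "f \<bullet> w i > 0" if "i < n" for i
  proof (cases "i \<le> j")
    case True
    then show ?thesis using f[of i] by (simp add: Ki)
  next
    case False
    then show ?thesis using path[of "n - 1 - i"] that j by (simp add: y_def)
  qed
  then have "f \<bullet> w i > 0" for i
    using periodic_mod[of w n i] polygon_period[OF P] n by (metis mod_less_divisor less_le_trans zero_less_numeral)
  then show False using no unfolding open_hemisphere_def by blast
qed

lemma simple_polygon_uminus: "simple_polygon (\<lambda>i. - w i) = simple_polygon w"
  by (simp add: simple_polygon_def arcs_cross_uminus)

lemma inflection_count_uminus:
  assumes "polygon w n" "3 \<le> n"
  shows "inflection_count (\<lambda>i. - w i) n = inflection_count w n"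
  unfolding inflection_count_def left_turn_uminus[OF assms] by simp

lemma ear_uminus: "ear (\<lambda>i. - w i) n = ear w n"
  by (simp add: ear_def in_cone_uminus)

lemma inflection_ear_first:
  assumes IH: "\<And>m. 4 \<le> m \<Longrightarrow> m < n \<Longrightarrow> crossings_inflections_bound m" and P: "polygon w n" and n: "5 \<le> n"
    and simple: "simple_polygon w" and I: "inflection_count w n < 4" and no: "\<not> open_hemisphere w"
    and turn: "left_turn w n 0 \<noteq> left_turn w n 1"
  shows "ear w n"
proof (cases "left_turn w n 0")
  case False
  then show ?thesis using inflection_ear_right[OF IH P n simple I no] turn by simp
next
  case True
  have "ear (\<lambda>i. - w i) n"
    by (rule inflection_ear_right[OF IH polygon_uminus[OF P] n])
      (use True turn simple I no P n in \<open>simp_all add: simple_polygon_uminus inflection_count_uminus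
        open_hemisphere_uminus left_turn_uminus\<close>)
  then show ?thesis by (simp add: ear_uminus)
qed

text \<open>The first edge is the one from \<open>w 1\<close> to \<open>w 0\<close>.\<close>

definition reversed :: "(nat \<Rightarrow> real^3) \<Rightarrow> nat \<Rightarrow> nat \<Rightarrow> real^3" where
  "reversed w n i = w (Suc n - i mod n)"

lemma reversed_simps:
  assumes "polygon w n" "i < n"
  shows "reversed w n i = w (Suc (n - i))" "reversed w n (Suc i) = w (n - i)"
proof -
  show "reversed w n i = w (Suc (n - i))" using assms by (simp add: reversed_def Suc_diff_le)
  show "reversed w n (Suc i) = w (n - i)"
  proof (cases "Suc i = n")
    case True
    then have "n - i = 1" by simp
    then show ?thesis using True polygon_period[OF assms(1), of 1] by (simp add: reversed_def)
  next
    case False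
    then show ?thesis using assms by (simp add: reversed_def)
  qed
qed

lemma polygon_reversed:
  assumes P: "polygon w n" and n: "0 < n"
  shows "polygon (reversed w n) n" "range (reversed w n) = range w"
proof -
  have per: "reversed w n (i + n) = reversed w n i" for i by (simp add: reversed_def)
  have "range (reversed w n) \<subseteq> range w" by (auto simp: reversed_def)
  moreover have "w i \<in> range (reversed w n)" for i
  proof -
    have "w i \<in> range (\<lambda>i. w (i + 2))" unfolding range_shift[OF P n] by simp
    then obtain j where "w i = w (j + 2)" by auto
    moreover have "w (j mod n + 2) = w (j + 2)"
      using periodic_mod[of "\<lambda>i. w (i + 2)" n j] polygon_period[OF polygon_shift[OF P, of 2]] by simp
    moreover have "reversed w n (n - 1 - j mod n) = w (j mod n + 2)"
      using reversed_simps(1)[OF P, of "n - 1 - j mod n"] n mod_less_divisor[OF n, of j] by simp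
    ultimately show ?thesis by (metis rangeI)
  qed
  ultimately show r: "range (reversed w n) = range w" by auto
  have "card (reversed w n ` {..<n}) = card (range (reversed w n))"
  proof -
    have "reversed w n i = reversed w n (i mod n)" for i by (simp add: reversed_def)
    then have "range (reversed w n) = reversed w n ` {..<n}" using n by (auto simp: image_iff) (metis mod_less_divisor lessThan_iff)
    then show ?thesis by simp
  qed
  then have "inj_on (reversed w n) {..<n}"
    using polygon_finite_range(3)[OF P n] by (intro eq_card_imp_inj_on) (auto simp: r)
  then show "polygon (reversed w n) n" using P per r by (simp add: polygon_def)
qed

lemma left_turn_reversed:
  assumes P: "polygon w n" and n: "3 \<le> n" and i: "i \<le> n"
  shows "left_turn (reversed w n) n i = (\<not> left_turn w n (Suc n - i))"
proof -
  have n0: "0 < n" using n by simp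
  note R = polygon_reversed(1)[OF P n0]
  have *: "left_turn (reversed w n) n i = (\<not> left_turn w n (Suc n - i))" if i: "1 \<le> i" "i \<le> n" for i
  proof -
    obtain l where l: "i = Suc l" "l < n" using i by (cases i) auto
    define h where "h = n - Suc l"
    have h: "n - l = Suc h" "Suc n - i = Suc h" using l by (auto simp: h_def)
    have "reversed w n (Suc (Suc l)) = w h"
    proof (cases "Suc l < n")
      case True
      then show ?thesis using reversed_simps(2)[OF P, of "Suc l"] by (simp add: h_def)
    next
      case False
      then have "Suc l = n" using l by simp
      then have "reversed w n (Suc (Suc l)) = reversed w n 1" "h = 0"
        using polygon_period[OF R, of 1] by (auto simp: h_def)
      then show ?thesis using reversed_simps(2)[OF P, of 0] n polygon_period[OF P, of 0] by simp
    qed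
    then have "left_turn (reversed w n) n i = pos (w (Suc (Suc h))) (w (Suc h)) (w h)"
      unfolding l(1) left_turn_Suc[OF R] using reversed_simps[OF P l(2)] by (simp add: h)
    also have "\<dots> = (\<not> pos (w h) (w (Suc h)) (w (Suc (Suc h))))"
      using det3_permute(3)[of "w h" "w (Suc h)" "w (Suc (Suc h))", OF refl] polygon_det_nonzero[OF P n, of h]
      by auto
    also have "pos (w h) (w (Suc h)) (w (Suc (Suc h))) = left_turn w n (Suc n - i)"
      unfolding h(2) left_turn_Suc[OF P] ..
    finally show ?thesis .
  qed
  show ?thesis
  proof (cases "i = 0")
    case True
    have "left_turn (reversed w n) n 0 = left_turn (reversed w n) n n"
      using left_turn_period[OF R n0, of 0] by simp
    moreover have "left_turn w n (Suc n) = left_turn w n 1"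
      using left_turn_period[OF P n0, of 1] by simp
    ultimately show ?thesis using *[of n] True n by simp
  qed (use * i in simp)
qed

lemma inflection_count_reversed:
  assumes P: "polygon w n" and n: "3 \<le> n"
  shows "inflection_count (reversed w n) n = inflection_count w n"
proof -
  let ?g = "\<lambda>i. of_bool (left_turn w n i \<noteq> left_turn w n (Suc i)) :: nat"
  have "inflection_count (reversed w n) n = (\<Sum>i<n. ?g (Suc (n - Suc i)))"
    unfolding inflection_count_def
    by (intro sum.cong refl) (auto simp: left_turn_reversed[OF P n] Suc_diff_le Suc_diff_Suc)
  also have "\<dots> = (\<Sum>i<n. ?g (Suc i))"
    by (rule sum.nat_diff_reindex)
  also have "\<dots> = (\<Sum>i<n. ?g i)"
  proof -
    have "0 < n" using n by simp
    then have "?g (i + n) = ?g i" for i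
      using left_turn_period[OF P, of i] left_turn_period[OF P, of "Suc i"] by simp
    from sum_shift_period[of ?g n 1, OF this] show ?thesis by simp
  qed
  finally show ?thesis by (simp add: inflection_count_def)
qed

lemma simple_polygon_reversed:
  assumes P: "polygon w n" and n: "0 < n" and "simple_polygon w"
  shows "simple_polygon (reversed w n)"
proof -
  have "\<exists>l. reversed w n i = w (Suc l) \<and> reversed w n (Suc i) = w l" for i
  proof -
    have "reversed w n i = reversed w n (i mod n)" "reversed w n (Suc i) = reversed w n (Suc (i mod n))"
      using n by (simp_all add: reversed_def mod_Suc)
    then show ?thesis using reversed_simps[OF P, of "i mod n"] n by auto
  qed
  then show ?thesis
    using assms(3) unfolding simple_polygon_def by (metis arcs_cross_commute(2,3))
qed

lemma in_cone_rev: "in_cone c b a x = in_cone a b c x"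
  unfolding in_cone_def
  by (auto simp: det3_permute[of a b c, OF refl] det3_permute[of a b x, OF refl] det3_permute[of b c x, OF refl]
    det3_permute[of a c x, OF refl])

text \<open>Reversal starts with the edge from \<open>w 1\<close> to \<open>w 0\<close> and so
  exchanges the two ends of the inflection.\<close>

lemma inflection_ear_second:
  assumes IH: "\<And>m. 4 \<le> m \<Longrightarrow> m < n \<Longrightarrow> crossings_inflections_bound m" and P: "polygon w n" and n: "5 \<le> n"
    and simple: "simple_polygon w" and I: "inflection_count w n < 4" and no: "\<not> open_hemisphere w"
    and turn: "left_turn w n 0 \<noteq> left_turn w n 1"
  shows "ear (\<lambda>i. w (i + 1)) n"
proof -
  have n0: "0 < n" "3 \<le> n" using n by auto
  have lt: "left_turn w n n = left_turn w n 0" "left_turn w n (Suc n) = left_turn w n 1"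
    using left_turn_period[OF P n0(1), of 0] left_turn_period[OF P n0(1), of 1] by simp_all
  have "ear (reversed w n) n"
    by (rule inflection_ear_first[OF IH polygon_reversed(1)[OF P n0(1)] n])
      (use P n n0 simple I no turn lt in \<open>simp_all add: simple_polygon_reversed inflection_count_reversed
        left_turn_reversed polygon_reversed(2) open_hemisphere_range\<close>)
  then have *: "\<not> in_cone (reversed w n (n - 1)) (reversed w n 0) (reversed w n 1) (reversed w n j)" if "2 \<le> j" "j \<le> n - 2" for j
    using that by (auto simp: ear_def)
  have w: "w n = w 0" "w (Suc n) = w 1" using polygon_period[OF P, of 0] polygon_period[OF P, of 1] by simp_all
  have "reversed w n (n - 1) = w 2" "reversed w n 0 = w 1" "reversed w n 1 = w 0"
    using reversed_simps[OF P, of "n - 1"] reversed_simps[OF P, of 0] n w by (simp_all add: numeral_2_eq_2)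
  then have "\<not> in_cone (w 0) (w 1) (w 2) (w (j + 1))" if "2 \<le> j" "j \<le> n - 2" for j
    using *[of "n - j"] reversed_simps(1)[OF P, of "n - j"] that in_cone_rev[of "w 2" "w 1" "w 0"] n by simp
  then show ?thesis using n w by (simp add: ear_def numeral_2_eq_2)
qed

section \<open>Essential vertices and the argument for simple polygons\<close>

lemma in_cone_inner_pos:
  assumes "in_cone a b c x" "v \<bullet> a > 0" "v \<bullet> b > 0" "v \<bullet> c > 0"
  shows "v \<bullet> x > 0"
proof -
  have e: "det3 a b c * (v \<bullet> x) = det3 b c x * (v \<bullet> a) + (- det3 a c x) * (v \<bullet> b) + det3 a b x * (v \<bullet> c)"
    using arg_cong[OF cramer[of a b c x], of "\<lambda>x. v \<bullet> x"] det3_permute(4)[of x b c, OF refl] det3_permute(2)[of a x c, OF refl]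
    by (simp add: inner_add_right)
  show ?thesis
  proof (cases "det3 a b c > 0")
    case True
    then have "det3 b c x > 0" "- det3 a c x > 0" "det3 a b x > 0" using assms(1) by (auto simp: in_cone_def)
    then have "det3 a b c * (v \<bullet> x) > 0" unfolding e using assms by (intro add_pos_pos mult_pos_pos)
    then show ?thesis using True by (simp add: zero_less_mult_iff)
  next
    case False
    then have "det3 b c x < 0" "- det3 a c x < 0" "det3 a b x < 0" "det3 a b c < 0" using assms(1) by (auto simp: in_cone_def)
    then have "det3 a b c * (v \<bullet> x) < 0" unfolding e using assms by (intro add_neg_neg mult_neg_pos)
    then show ?thesis using \<open>det3 a b c < 0\<close> by (simp add: mult_less_0_iff)
  qed
qed

text \<open>The vertices whose deletion leaves a polygon in an open hemisphere, so that the
  induction hypothesis would not apply to it.\<close>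

definition essential :: "(nat \<Rightarrow> real^3) \<Rightarrow> nat \<Rightarrow> bool" where
  "essential w l \<longleftrightarrow> (\<exists>v. \<forall>x\<in>range w - {w l}. v \<bullet> x > 0)"

text \<open>The inflections that deletion may create are paid for by the crossings it loses: the
  extra terms of the two count lemmas cancel.\<close>

lemma removable_ear_cost:
  assumes P: "polygon w n" and n: "5 \<le> n" and T: "crossings_inflections_bound (n - 1)" and ear: "ear w n" and ess: "\<not> essential w 0"
  shows "4 \<le> crossing_count w n + inflection_count w n"
proof -
  let ?w' = "prefix_polygon (\<lambda>i. w (Suc i)) (n - 1)"
  have "polygon (\<lambda>i. w (i + 1)) n" by (rule polygon_shift[OF P])
  then have P': "polygon ?w' (n - 1)" using n by (intro polygon_prefix_polygon[of _ n]) auto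
  have "w i \<in> range ?w' \<union> {w 0}" for i
  proof -
    have "w i = w (i mod n)" using periodic_mod[of w n i] polygon_period[OF P] by simp
    moreover have "w l \<in> range ?w' \<union> {w 0}" if "l < n" for l
    proof (cases l)
      case (Suc l')
      then have "?w' l' = w l" using that by (simp add: prefix_polygon_simps)
      then show ?thesis by (metis UnI1 rangeI)
    qed auto
    ultimately show ?thesis using n by simp
  qed
  then have "\<not> open_hemisphere ?w'"
    using ess unfolding essential_def open_hemisphere_range by blast
  then have "4 \<le> crossing_count ?w' (n - 1) + inflection_count ?w' (n - 1)"
    using T P' unfolding crossings_inflections_bound_def by blast
  then show ?thesis
    using crossing_count_remove[OF P n ear] inflection_count_remove[OF P n ear] by linarith
qed

lemma four_essential_contradiction:
  assumes P: "polygon w n" and n: "5 \<le> n" and no: "\<not> open_hemisphere w"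
    and ess: "\<And>l. l \<in> L \<Longrightarrow> l < n \<and> essential w l" and L: "card L = 4"
  shows False
proof -
  have fin: "finite L" using L card.infinite by fastforce
  obtain p q r s where pqrs: "L = {p, q, r, s}" "distinct [p, q, r, s]"
    using L by (auto simp: card_Suc_eq numeral_eq_Suc)
  \<comment> \<open>With at least five vertices there is a further one outside \<open>L\<close>,
    which plays the part of \<open>e\<close> in
    \<open>four_nonremovable_contradiction\<close>.\<close>
  have "card (L) < card {..<n}" using L n by simp
  then have "\<not> {..<n} \<subseteq> L" by (metis card_mono fin not_le)
  then obtain e where e: "e < n" "e \<notin> L" by auto
  have ne: "w i \<noteq> w i'" if "i < n" "i' < n" "i \<noteq> i'" for i i'
    using polygon_eq_iff[OF P] that by blast
  have l: "p < n" "q < n" "r < n" "s < n" using ess pqrs by auto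
  show False
  proof (rule four_nonremovable_contradiction[of "range w" "w p" "w q" "w r" "w s" "w e"])
    show "finite (range w)" using polygon_finite_range[OF P] n by simp
    show "general_position (range w)" using P by (simp add: polygon_def)
    show "\<nexists>v. \<forall>x\<in>range w. 0 < v \<bullet> x" using no by (simp add: open_hemisphere_range)
    show "distinct [w p, w q, w r, w s]" using pqrs(2) l by (auto simp: ne)
    show "w e \<notin> {w p, w q, w r, w s}" using e pqrs l by (auto simp: ne)
    show "\<exists>v. \<forall>y\<in>range w - {x}. 0 < v \<bullet> y" if "x \<in> {w p, w q, w r, w s}" for x
      using that ess[of p] ess[of q] ess[of r] ess[of s] pqrs unfolding essential_def by auto
  qed auto
qed

lemma essential_shift:
  assumes "polygon w n" "0 < n"
  shows "essential (\<lambda>i. w (i + l)) m = essential w (m + l)"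
  unfolding essential_def range_shift[OF assms] ..

text \<open>A functional positive on the corners of a triangle is positive inside it, so it would be
  positive on the whole polygon.\<close>

lemma inside_not_essential:
  assumes P: "polygon w n" and no: "\<not> open_hemisphere w" and T: "in_cone (w i) (w j) (w k) (w l)"
    and ne: "w l \<noteq> w i" "w l \<noteq> w j" "w l \<noteq> w k"
  shows "\<not> essential w l"
proof
  assume "essential w l"
  then obtain v where v: "\<And>x. x \<in> range w \<Longrightarrow> x \<noteq> w l \<Longrightarrow> v \<bullet> x > 0" unfolding essential_def by blast
  then have "v \<bullet> w l > 0" using ne by (intro in_cone_inner_pos[OF T] v) auto
  then have "\<forall>x\<in>range w. v \<bullet> x > 0" using v by metis
  then show False using no unfolding open_hemisphere_range by blast
qed

lemma simple_case:
  assumes IH: "\<And>m. 4 \<le> m \<Longrightarrow> m < n \<Longrightarrow> crossings_inflections_bound m" and P: "polygon w n" and n: "5 \<le> n"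
    and simple: "simple_polygon w" and no: "\<not> open_hemisphere w"
  shows "4 \<le> inflection_count w n"
proof (rule ccontr)
  assume I: "\<not> 4 \<le> inflection_count w n"
  have n0: "0 < n" using n by simp
  have ear_ess: "essential w l" if "ear (\<lambda>i. w (i + l)) n" for l
  proof (rule ccontr)
    assume "\<not> essential w l"
    then have "4 \<le> crossing_count (\<lambda>i. w (i + l)) n + inflection_count (\<lambda>i. w (i + l)) n"
      using that P n IH[of "n - 1"] by (intro removable_ear_cost polygon_shift) (auto simp: essential_shift[OF P n0])
    then show False
      using I crossing_count_simple[OF simple, of n] by (simp add: crossing_count_shift[OF P] inflection_count_shift[OF P n0])
  qed
  have "\<exists>m<n. \<not> essential w m"
  proof (rule ccontr)
    assume "\<not> ?thesis"
    then show False
      by (intro four_essential_contradiction[OF P n no, of "{0, 1, 2, 3}"]) (use n in auto)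
  qed
  then obtain m where m: "m < n" "\<not> essential w m" by blast
  define W where "W i = w (i + m)" for i
  have PW: "polygon W n" and sW: "simple_polygon W"
    using polygon_shift[OF P] simple_polygon_shift[OF simple] unfolding W_def by blast+
  have rW: "range W = range w" unfolding W_def by (rule range_shift[OF P n0])
  have noW: "\<not> open_hemisphere W" using no by (simp add: open_hemisphere_range rW)
  have IW: "inflection_count W n < 4" using I inflection_count_shift[OF P n0, of m] by (simp add: W_def[abs_def])
  have earW: "essential W l" if "ear (\<lambda>i. W (i + l)) n" for l
    using ear_ess[of "l + m"] that essential_shift[OF P n0, of m l] by (simp add: W_def[abs_def] add.assoc)
  have m0: "\<not> essential W 0" using m essential_shift[OF P n0, of m 0] by (simp add: W_def[abs_def])
  then have "\<not> ear W n" using earW[of 0] by auto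
  then have "\<exists>j\<in>{2..n - 2}. in_cone (W (n - 1)) (W 0) (W 1) (W j)" by (auto simp: ear_def)
  from inside_vertex_turn[OF PW _ sW this] n obtain j where j: "2 \<le> j" "j \<le> n - 2"
    and p: "in_cone (W (n - 1)) (W 0) (W 1) (W j)"
    and tj: "pos (W (j - 1)) (W j) (W (Suc j)) \<noteq> pos (W (n - 1)) (W 0) (W 1)" by auto
  have Wj: "\<not> essential W j"
    by (rule inside_not_essential[OF PW noW p]) (use polygon_eq_iff[OF PW] j n in auto)
  have lt: "left_turn W n j \<noteq> left_turn W n 0"
    using tj left_turn_Suc[OF PW, of "j - 1"] j by (simp add: left_turn_def)
  have inflW: "essential W i \<and> essential W (Suc i)" if "left_turn W n i \<noteq> left_turn W n (Suc i)" for i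
  proof -
    let ?V = "\<lambda>l. W (l + i)"
    have PV: "polygon ?V n" by (rule polygon_shift[OF PW])
    have h: "\<not> open_hemisphere ?V" using noW by (simp add: open_hemisphere_range range_shift[OF PW n0])
    have t: "left_turn ?V n 0 \<noteq> left_turn ?V n 1" using that by (simp add: left_turn_shift[OF n0])
    have I': "inflection_count ?V n < 4" using IW by (simp add: inflection_count_shift[OF PW n0])
    have "ear ?V n" "ear (\<lambda>l. ?V (l + 1)) n"
      using inflection_ear_first[OF IH PV n simple_polygon_shift[OF sW] I' h t]
        inflection_ear_second[OF IH PV n simple_polygon_shift[OF sW] I' h t] by auto
    then show ?thesis using earW[of i] earW[of "Suc i"] by simp
  qed
  have Wn: "essential W n = essential W 0" "left_turn W n n = left_turn W n 0"
    using polygon_period[OF PW, of 0] left_turn_period[OF PW n0, of 0] by (simp_all add: essential_def)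
  have jn: "j < n" using j n by simp
  \<comment> \<open>\<open>W 0\<close> and \<open>W j\<close> turn oppositely, so each of the two
    paths between them contains an inflection.\<close>
  obtain i1 where i1: "i1 < j" "left_turn W n i1 \<noteq> left_turn W n (Suc i1)"
    using turn_change[of 0 j "left_turn W n"] j lt by auto
  obtain i2 where i2: "j \<le> i2" "i2 < n" "left_turn W n i2 \<noteq> left_turn W n (Suc i2)"
    using turn_change[of j n "left_turn W n", OF jn] lt Wn(2) by auto
  note i = i1 i2
  have e: "essential W i1" "essential W (Suc i1)" "essential W i2" "essential W (Suc i2)"
    using inflW i by auto
  \<comment> \<open>The ends of inflections are essential while \<open>W 0\<close> and
    \<open>W j\<close> are not; hence the two inflections share no vertex.\<close>
  have "Suc i1 \<noteq> j" "i2 \<noteq> j" "i1 \<noteq> 0" "Suc i2 \<noteq> n"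
    using e Wj m0 Wn(1) by (metis, metis, metis, metis)
  then have "card {i1, Suc i1, i2, Suc i2} = 4" "\<And>l. l \<in> {i1, Suc i1, i2, Suc i2} \<Longrightarrow> l < n"
    using i by auto
  then show False
    using four_essential_contradiction[OF PW n noW, of "{i1, Suc i1, i2, Suc i2}"] e by auto
qed

section \<open>Polygons with a single crossing\<close>

lemma eventually_pos:
  fixes x :: "real^3"
  shows "0 < v \<bullet> x \<Longrightarrow> \<forall>\<^sub>F x' in nhds x. 0 < v \<bullet> x'" "v \<bullet> x < 0 \<Longrightarrow> \<forall>\<^sub>F x' in nhds x. v \<bullet> x' < 0"
  by (auto intro!: eventually_nhds_in_open open_halfspace_gt open_halfspace_lt
      simp: eventually_nhds exI[of _ "{x. 0 < v \<bullet> x}"] exI[of _ "{x. v \<bullet> x < 0}"])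

lemma eventually_det3:
  shows "0 < det3 x a b \<Longrightarrow> \<forall>\<^sub>F x' in nhds x. 0 < det3 x' a b" "det3 x a b < 0 \<Longrightarrow> \<forall>\<^sub>F x' in nhds x. det3 x' a b < 0"
  using eventually_pos[of "cross3 a b" x] by (simp_all add: inner_cross3_det3)

lemma eventually_pos_det3:
  assumes "det3 x a b \<noteq> 0"
  shows "\<forall>\<^sub>F x' in nhds x. det3 x' a b \<noteq> 0 \<and> pos x' a b = pos x a b"
proof (cases "pos x a b")
  case True
  then show ?thesis by (rule eventually_mono[OF eventually_det3(1)]) (use True in auto)
next
  case False
  then have "det3 x a b < 0" using assms by simp
  then show ?thesis by (rule eventually_mono[OF eventually_det3(2)]) (use False in auto)
qed

text \<open>A part of an uncrossed arc is uncrossed. The signs that exclude the crossing are strict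
  at \<open>x\<close>, so they persist for nearby \<open>x'\<close>, which need not lie on the
  arc.\<close>

lemma subarc_uncrossed:
  assumes gp: "general_position S" and S: "a \<in> S" "b \<in> S" "p \<in> S" "q \<in> S" and ne: "a \<noteq> b" "p \<noteq> q"
    and nc: "\<not> arcs_cross a b p q" and x: "x = \<alpha> *\<^sub>R a + \<beta> *\<^sub>R b" "\<alpha> > 0" "\<beta> > 0"
  shows "\<forall>\<^sub>F x' in nhds x. \<not> arcs_cross a x' p q"
proof -
  have det: "det3 x y z = \<alpha> * det3 a y z + \<beta> * det3 b y z" for y z
    unfolding x(1) det3_expand by (simp add: algebra_simps)
  \<comment> \<open>For an edge ending at \<open>b\<close>, a crossing would require opposite signs
    of \<open>det3 a b z\<close> and \<open>det3 x' b z\<close>, which agree near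
    \<open>x\<close>.\<close>
  have *: "\<forall>\<^sub>F x' in nhds x. \<not> arcs_cross a x' b z" if "z \<in> S" "z \<noteq> b" for z
  proof (cases "z = a")
    case False
    have nz: "det3 a b z \<noteq> 0" using gp S(1,2) that ne False unfolding general_position_def by auto
    have "det3 x b z = \<alpha> * det3 a b z" using det by simp
    then have "det3 x b z \<noteq> 0" "pos x b z = pos a b z" using nz x(2) by (auto simp: zero_less_mult_iff)
    then have "\<forall>\<^sub>F x' in nhds x. det3 x' b z \<noteq> 0 \<and> pos x' b z = pos a b z"
      using eventually_pos_det3[of x b z] by simp
    then show ?thesis by (rule eventually_mono) (auto simp: arcs_cross_def)
  qed simp
  consider "p = a \<or> q = a" | "p = b" | "q = b" | "p \<notin> {a, b}" "q \<notin> {a, b}" by auto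
  then show ?thesis
  proof cases
    case 1
    then show ?thesis by auto
  next
    case 2
    then show ?thesis using *[of q] S ne by simp
  next
    case 3
    then show ?thesis using *[of p] S ne arcs_cross_commute(3)[of a _ p b] by simp
  next
    case 4
    then have nz: "det3 a b p \<noteq> 0" "det3 a b q \<noteq> 0" "det3 a p q \<noteq> 0" "det3 b p q \<noteq> 0"
      using gp S ne unfolding general_position_def by auto
    have e: "det3 x p a = \<beta> * det3 a b p" "det3 x q a = \<beta> * det3 a b q"
      unfolding det using det3_permute(4)[of a b p, OF refl] det3_permute(4)[of a b q, OF refl] by simp_all
    have ev: "\<forall>\<^sub>F x' in nhds x. pos x' p a = pos a b p \<and> pos x' q a = pos a b q"
      using eventually_conj[OF eventually_pos_det3[of x p a] eventually_pos_det3[of x q a]] nz x(3)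
      by (auto simp: e zero_less_mult_iff elim!: eventually_mono)
    have r: "det3 a x' p = det3 x' p a" "det3 a x' q = det3 x' q a" for x'
      using det3_permute(5)[of x' p a, OF refl] det3_permute(5)[of x' q a, OF refl] by simp_all
    \<comment> \<open>In the first two cases the other signs would allow a crossing, so
      \<open>det3 b p q\<close> has the wrong sign, and so has its positive combination
      \<open>det3 x p q\<close>. In the third case the signs already exclude a crossing.\<close>
    consider "pos a b p" "\<not> pos a b q" "\<not> pos a p q" | "\<not> pos a b p" "pos a b q" "pos a p q"
      | "pos a b p = pos a b q \<or> pos a b p = pos a p q" by blast
    then show ?thesis
    proof cases
      case 1
      then have "det3 b p q < 0" using nc nz unfolding arcs_cross_def by auto
      moreover have "det3 a p q < 0" using 1 nz by auto
      ultimately have "det3 x p q < 0" unfolding det using x by (intro add_neg_neg mult_pos_neg)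
      from eventually_conj[OF ev eventually_det3(2)[OF this]] show ?thesis
        by (rule eventually_mono) (use 1 in \<open>auto simp: arcs_cross_def r\<close>)
    next
      case 2
      then have "det3 b p q > 0" using nc nz unfolding arcs_cross_def by auto
      then have "det3 x p q > 0" unfolding det using x 2 by (intro add_pos_pos mult_pos_pos)
      from eventually_conj[OF ev eventually_det3(1)[OF this]] show ?thesis
        by (rule eventually_mono) (use 2 in \<open>auto simp: arcs_cross_def r\<close>)
    next
      case 3
      from ev show ?thesis
        by (rule eventually_mono) (use 3 in \<open>auto simp: arcs_cross_def r\<close>)
    qed
  qed
qed

text \<open>The sign of \<open>neg\<close> says that the loop \<open>w 1, ..., w t\<close> turns right at the crossing point \<open>x\<close>. The loop is closed at a point \<open>x'\<close>
  near \<open>x\<close> to keep general position.\<close>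

lemma loop_in_hemisphere:
  assumes IH: "\<And>m. 4 \<le> m \<Longrightarrow> m < n \<Longrightarrow> crossings_inflections_bound m" and P: "polygon w n" and n: "5 \<le> n"
    and turn: "\<And>i. left_turn w n i" and t: "2 \<le> t" "t \<le> n - 2"
    and cross: "arcs_cross (w 0) (w 1) (w t) (w (Suc t))"
    and unique: "\<And>i j. i < n \<Longrightarrow> j < n \<Longrightarrow> arcs_cross (w i) (w (Suc i)) (w j) (w (Suc j)) \<Longrightarrow> (i, j) = (0, t) \<or> (i, j) = (t, 0)"
    and neg: "\<not> pos (w 1) (w t) (w (Suc t))"
  shows "open_hemisphere w"
proof -
  have ne: "w i \<noteq> w i'" if "i < n" "i' < n" "i \<noteq> i'" for i i'
    using polygon_eq_iff[OF P] that by blast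
  have gp: "general_position (range w)" using P by (simp add: polygon_def)
  have wn: "w n = w 0" using polygon_period[OF P, of 0] by simp
  have tn: "t < n" "Suc t < n" using t n by auto
  have lt: "pos (w i) (w (Suc i)) (w (Suc (Suc i)))" for i
    using turn[of "Suc i"] left_turn_Suc[OF P] by simp
  have "t \<noteq> 2" using lt[of 1] neg by (auto simp: numeral_2_eq_2)
  then have t3: "3 \<le> t" using t by simp
  obtain \<alpha> \<beta> \<gamma> \<delta> :: real where pos: "\<alpha> > 0" "\<beta> > 0" "\<gamma> > 0" "\<delta> > 0"
    and eq: "\<alpha> *\<^sub>R w 0 + \<beta> *\<^sub>R w 1 = \<gamma> *\<^sub>R w t + \<delta> *\<^sub>R w (Suc t)"
    using arcs_cross_imp_combination[OF cross] .
  define x where "x = \<alpha> *\<^sub>R w 0 + \<beta> *\<^sub>R w 1"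
  have x1: "x = \<beta> *\<^sub>R w 1 + \<alpha> *\<^sub>R w 0" by (simp add: x_def)
  have x2: "x = \<gamma> *\<^sub>R w t + \<delta> *\<^sub>R w (Suc t)" "x = \<delta> *\<^sub>R w (Suc t) + \<gamma> *\<^sub>R w t"
    unfolding x_def eq by (simp_all add: add.commute)
  have d1: "det3 x y z = \<alpha> * det3 (w 0) y z + \<beta> * det3 (w 1) y z" for y z
    unfolding x_def det3_expand by (simp add: algebra_simps)
  have d2: "det3 x y z = \<gamma> * det3 (w t) y z + \<delta> * det3 (w (Suc t)) y z" for y z
    unfolding x2(1) det3_expand by (simp add: algebra_simps)
  have we: "w i \<noteq> w (Suc i)" if "i < n" for i
    using ne[of i "Suc i"] ne[of "n - 1" 0] that n wn by (cases "Suc i = n") auto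
  have "\<forall>\<^sub>F x' in nhds x. \<not> arcs_cross (w 1) x' (w i) (w (Suc i)) \<and> \<not> arcs_cross (w t) x' (w i) (w (Suc i)) \<and> \<not> arcs_cross (w (Suc t)) x' (w i) (w (Suc i))"
    if i: "i \<in> {..<n} - {0, t}" for i
  proof -
    have "\<not> arcs_cross (w 0) (w 1) (w i) (w (Suc i))" "\<not> arcs_cross (w t) (w (Suc t)) (w i) (w (Suc i))"
      using unique[of 0 i] unique[of t i] i n t tn by auto
    then have nc: "\<not> arcs_cross (w 1) (w 0) (w i) (w (Suc i))" "\<not> arcs_cross (w t) (w (Suc t)) (w i) (w (Suc i))"
      "\<not> arcs_cross (w (Suc t)) (w t) (w i) (w (Suc i))"
      using arcs_cross_commute(2)[of "w 0" "w 1"] arcs_cross_commute(2)[of "w t" "w (Suc t)"] by auto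
    have r: "w l \<in> range w" for l by simp
    have n10: "w 1 \<noteq> w 0" using ne[of 1 0] n by simp
    have nt: "w t \<noteq> w (Suc t)" "w (Suc t) \<noteq> w t" using we[of t] tn by auto
    have wi: "w i \<noteq> w (Suc i)" using we i by simp
    show ?thesis
      using subarc_uncrossed[OF gp r r r r n10 wi nc(1) x1 pos(2,1)]
        subarc_uncrossed[OF gp r r r r nt(1) wi nc(2) x2(1) pos(3,4)]
        subarc_uncrossed[OF gp r r r r nt(2) wi nc(3) x2(2) pos(4,3)]
      by (intro eventually_conj)
  qed
  then have ev1: "\<forall>\<^sub>F x' in nhds x. \<forall>i\<in>{..<n} - {0, t}. \<not> arcs_cross (w 1) x' (w i) (w (Suc i)) \<and> \<not> arcs_cross (w t) x' (w i) (w (Suc i))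
      \<and> \<not> arcs_cross (w (Suc t)) x' (w i) (w (Suc i))"
    by (intro eventually_ball_finite) auto
  have "0 < det3 x (w 1) (w 2)"
    unfolding d1 using lt[of 0] pos by (simp add: numeral_2_eq_2)
  note ev2 = eventually_det3(1)[OF this]
  have n1t: "det3 (w 1) (w t) (w (Suc t)) < 0"
  proof -
    have "w 1 \<noteq> w t" "w t \<noteq> w (Suc t)" "w 1 \<noteq> w (Suc t)" using ne t tn by auto
    then have "det3 (w 1) (w t) (w (Suc t)) \<noteq> 0" using gp unfolding general_position_def by blast
    then show ?thesis using neg by simp
  qed
  \<comment> \<open>Seen from the crossing point, \<open>w (Suc t)\<close> lies in the left sector
    between \<open>w 1\<close> and \<open>w t\<close>: this is where the path outside the loop
    starts.\<close>
  have "0 < det3 x (w 1) (w (Suc t))" "0 < det3 x (w t) (w 1)"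
    using n1t pos det3_permute[of "w 1" "w t" "w (Suc t)", OF refl] unfolding d2 by (simp_all add: mult_pos_neg)
  note ev3 = eventually_det3(1)[OF this(1)] eventually_det3(1)[OF this(2)]
  from iffD1[OF eventually_nhds eventually_conj[OF ev1 eventually_conj[OF ev2 eventually_conj[OF ev3]]]]
  obtain U where U: "open U" "x \<in> U"
    and Ux: "\<forall>x'\<in>U. (\<forall>i\<in>{..<n} - {0, t}. \<not> arcs_cross (w 1) x' (w i) (w (Suc i)) \<and> \<not> arcs_cross (w t) x' (w i) (w (Suc i))
      \<and> \<not> arcs_cross (w (Suc t)) x' (w i) (w (Suc i))) \<and> pos x' (w 1) (w 2) \<and> pos x' (w 1) (w (Suc t)) \<and> pos x' (w t) (w 1)"
    by (elim exE conjE) (rule that)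
  have "finite (range w)" "3 \<le> card (range w)" "U \<noteq> {}"
    using polygon_finite_range[OF P] n U by auto
  then obtain x' where x': "x' \<in> U" "x' \<notin> range w" and gp': "general_position (insert x' (range w))"
    using general_position_extend[OF _ gp _ U(1)] by blast
  have xc: "\<not> arcs_cross (w 1) x' (w i) (w (Suc i))" "\<not> arcs_cross (w t) x' (w i) (w (Suc i))" "\<not> arcs_cross (w (Suc t)) x' (w i) (w (Suc i))"
    if "i < n" "i \<noteq> 0" "i \<noteq> t" for i using bspec[OF Ux x'(1)] that by auto
  have xp: "pos x' (w 1) (w 2)" "pos x' (w 1) (w (Suc t))" "pos x' (w t) (w 1)" using bspec[OF Ux x'(1)] by auto
  \<comment> \<open>The point \<open>x'\<close> takes the place of \<open>w 0\<close>, so that the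
    prefix of length \<open>Suc t\<close> is the closed loop.\<close>
  define u where "u i = (if i = 0 then x' else w i)" for i
  let ?m = "Suc t"
  let ?K = "prefix_polygon u ?m"
  have Ki: "?K i = u i" if "i \<le> t" for i using that by (simp add: prefix_polygon_simps)
  have rK: "range ?K = u ` {..<?m}" by (rule range_prefix_polygon) simp
  have usub: "u i \<in> insert x' (range w)" for i by (auto simp: u_def)
  have PK: "polygon ?K ?m"
  proof -
    have "inj_on ?K {..<?m}"
      using x'(2) tn by (auto simp: inj_on_def Ki less_Suc_eq_le u_def ne polygon_eq_iff[OF P])
    moreover have "general_position (range ?K)"
      by (rule general_position_subset[OF gp']) (use usub rK in auto)
    moreover have "?K (i + ?m) = ?K i" for i by (simp only: prefix_polygon_def mod_add_self2)
    ultimately show ?thesis by (simp only: polygon_def) simp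
  qed
  have m: "4 \<le> ?m" "?m < n" using t3 t by auto
  have Kedge: "?K i = x' \<and> ?K (Suc i) = w 1 \<or> ?K i = w t \<and> ?K (Suc i) = x' \<or>
     (\<exists>l. 1 \<le> l \<and> l < t \<and> ?K i = w l \<and> ?K (Suc i) = w (Suc l))" for i
  proof -
    have e: "?K i = u (i mod ?m)" "?K (Suc i) = u (if Suc (i mod ?m) = ?m then 0 else Suc (i mod ?m))"
      by (simp_all add: prefix_polygon_def mod_Suc)
    have "i mod ?m < ?m" by simp
    then consider "i mod ?m = 0" | "i mod ?m = t" "t \<noteq> 0" | "1 \<le> i mod ?m" "i mod ?m < t" by linarith
    then show ?thesis
    proof cases
      case 1
      then show ?thesis using e t by (simp add: u_def)
    next
      case 2
      then show ?thesis using e by (simp add: u_def)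
    next
      case 3
      then have "?K i = w (i mod ?m)" "?K (Suc i) = w (Suc (i mod ?m))" using e by (simp_all add: u_def)
      then show ?thesis using 3 by blast
    qed
  qed
  have uncrossed: "\<not> arcs_cross (w l) (w (Suc l)) (?K i) (?K (Suc i))" if l: "l < n" "l \<noteq> 0" "l \<noteq> t" for l i
    using Kedge[of i]
  proof (elim disjE exE conjE)
    assume "?K i = x'" "?K (Suc i) = w 1"
    then show ?thesis using xc(1)[OF l] arcs_cross_commute(1)[of "w l"] arcs_cross_commute(2)[of x' "w 1"] by simp
  next
    assume "?K i = w t" "?K (Suc i) = x'"
    then show ?thesis using xc(2)[OF l] arcs_cross_commute(1)[of "w l"] by simp
  next
    fix l' assume "1 \<le> l'" "l' < t" "?K i = w l'" "?K (Suc i) = w (Suc l')"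
    then show ?thesis using unique[of l l'] l t tn by auto
  qed
  have sK: "simple_polygon ?K"
    unfolding simple_polygon_def
  proof (intro allI)
    fix i j
    have A: "\<not> arcs_cross (?K i) (?K (Suc i)) (?K j) (?K (Suc j))" if "1 \<le> l" "l < t" "?K i = w l" "?K (Suc i) = w (Suc l)" for i j l
      using uncrossed[of l j] that tn by simp
    let ?E = "\<lambda>i. \<exists>l. 1 \<le> l \<and> l < t \<and> ?K i = w l \<and> ?K (Suc i) = w (Suc l)"
    consider "?E i" | "?E j" | "\<not> ?E i" "\<not> ?E j" by blast
    then show "\<not> arcs_cross (?K i) (?K (Suc i)) (?K j) (?K (Suc j))"
    proof cases
      case 1
      then show ?thesis using A by blast
    next
      case 2
      then show ?thesis using A[of _ j i] arcs_cross_commute(1)[of "?K i"] by blast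
    next
      case 3
      then have "?K i = x' \<and> ?K (Suc i) = w 1 \<or> ?K i = w t \<and> ?K (Suc i) = x'"
        "?K j = x' \<and> ?K (Suc j) = w 1 \<or> ?K j = w t \<and> ?K (Suc j) = x'"
        using Kedge[of i] Kedge[of j] by blast+
      then show ?thesis by (elim disjE conjE) simp_all
    qed
  qed
  have Kturn: "pos (?K (l - 1)) (?K l) (?K (Suc l))" if l: "1 \<le> l" "l \<le> ?m - 2" for l
  proof (cases "l = 1")
    case True
    then show ?thesis using xp(1) t3 by (simp add: Ki u_def numeral_2_eq_2)
  next
    case False
    then show ?thesis using lt[of "l - 1"] l by (simp add: Ki u_def)
  qed
  have ltK: "left_turn ?K ?m l" if l: "1 \<le> l" "l \<le> ?m - 2" for l
    using Kturn[OF l] left_turn_Suc[OF PK, of "l - 1"] l by simp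
  have "open_hemisphere ?K"
    by (rule convex_part_in_hemisphere[OF IH PK m(1) sK ltK]) (use m in auto)
  then obtain f where f: "\<And>i. f \<bullet> ?K i > 0" unfolding open_hemisphere_def by blast
  \<comment> \<open>The last point of this path, at \<open>n - 1 - t\<close>, is
    \<open>w n = w 0\<close>, the vertex that the loop does not contain.\<close>
  define y where "y i = w (Suc t + i)" for i
  have y_w: "y i = w (if Suc t + i = n then 0 else Suc t + i)" for i by (simp add: y_def wn)
  have path: "f \<bullet> y i > 0" if i: "i \<le> n - 1 - t" for i
  proof (rule trapped_path[OF PK m(1) sK Kturn f _ _ _ _ _ _ i])
    show "general_position (range ?K \<union> y ` {..n - 1 - t})"
      by (rule general_position_subset[OF gp']) (use rK usub in \<open>auto simp: y_def\<close>)
  next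
    fix i assume "i \<le> n - 1 - t"
    then show "y i \<notin> range ?K" unfolding rK y_w using x'(2) t tn by (auto simp: u_def ne split: if_splits)
  next
    fix i assume i: "i < n - 1 - t"
    have "Suc t + i < n" using i by simp
    then show "y i \<noteq> y (Suc i)" using we[of "Suc t + i"] by (simp add: y_def)
    show "crossings ?K ?m (y i) (y (Suc i)) = 0"
      by (rule crossings_eq_0) (use uncrossed[of "Suc t + i"] i in \<open>simp add: y_def\<close>)
  next
    show "crossings ?K ?m (?K 0) (y 0) = 0"
    proof (rule crossings_eq_0)
      fix i assume "i < ?m"
      show "\<not> arcs_cross (?K 0) (y 0) (?K i) (?K (Suc i))"
        using Kedge[of i]
      proof (elim disjE exE conjE)
        fix l assume "1 \<le> l" "l < t" "?K i = w l" "?K (Suc i) = w (Suc l)"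
        then show ?thesis using xc(3)[of l] tn arcs_cross_commute(2)[of x' "w (Suc t)"] by (simp add: Ki u_def y_def)
      qed (simp_all add: Ki u_def)
    qed
  next
    show "ccw (?K 0) (?K 1) (y 0) (?K (?m - 1))"
      using xp t3 by (simp add: Ki u_def y_def ccw_def)
  qed simp_all
  have "f \<bullet> w i > 0" if "i < n" for i
  proof -
    consider "i = 0" | "1 \<le> i" "i \<le> t" | "t < i" by linarith
    then show ?thesis
    proof cases
      case 1
      then show ?thesis using path[of "n - 1 - t"] t n by (simp add: y_def wn)
    next
      case 2
      then show ?thesis using f[of i] by (simp add: Ki u_def)
    next
      case 3
      then show ?thesis using path[of "i - Suc t"] that by (simp add: y_def)
    qed
  qed
  then have "f \<bullet> w i > 0" for i
    using periodic_mod[of w n i] polygon_period[OF P] n by (metis mod_less_divisor less_le_trans zero_less_numeral)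
  then show ?thesis unfolding open_hemisphere_def by blast
qed

text \<open>Of the two loops at the crossing exactly one turns right there; shifting the start to
  \<open>t\<close> exchanges them.\<close>

lemma all_left_turns_hemisphere:
  assumes IH: "\<And>m. 4 \<le> m \<Longrightarrow> m < n \<Longrightarrow> crossings_inflections_bound m" and P: "polygon w n" and n: "5 \<le> n"
    and turn: "\<And>i. left_turn w n i" and t: "2 \<le> t" "t \<le> n - 2"
    and cross: "arcs_cross (w 0) (w 1) (w t) (w (Suc t))"
    and unique: "\<And>i j. i < n \<Longrightarrow> j < n \<Longrightarrow> arcs_cross (w i) (w (Suc i)) (w j) (w (Suc j)) \<Longrightarrow> (i, j) = (0, t) \<or> (i, j) = (t, 0)"
  shows "open_hemisphere w"
proof (cases "pos (w 1) (w t) (w (Suc t))")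
  case False
  then show ?thesis using loop_in_hemisphere[OF IH P n turn t cross unique] by blast
next
  case True
  have n0: "0 < n" using n by simp
  have w: "w (i mod n) = w i" "w (Suc (i mod n)) = w (Suc i)" for i
    using periodic_mod[of w n i] periodic_mod[of "\<lambda>i. w (Suc i)" n i] polygon_period[OF P] polygon_period[OF P, of "Suc _"]
    by auto
  have wn: "w n = w 0" "w (Suc n) = w 1" using w[of n] by simp_all
  let ?V = "\<lambda>i. w (i + t)"
  have e: "n - t + t = n" using t by simp
  have "open_hemisphere ?V"
  proof (rule loop_in_hemisphere[OF IH polygon_shift[OF P] n, of t "n - t"])
    show "left_turn ?V n i" for i using turn by (simp add: left_turn_shift[OF n0])
    show "arcs_cross (w (0 + t)) (w (1 + t)) (w (n - t + t)) (w (Suc (n - t) + t))"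
      using cross arcs_cross_commute(1) e wn by simp
    show "\<not> pos (w (1 + t)) (w (n - t + t)) (w (Suc (n - t) + t))"
      using True cross det3_permute(5)[of "w 0" "w 1" "w (Suc t)", OF refl] e wn by (auto simp: arcs_cross_def)
    fix i j assume ij: "i < n" "j < n" "arcs_cross (w (i + t)) (w (Suc i + t)) (w (j + t)) (w (Suc j + t))"
    then have "arcs_cross (w ((i + t) mod n)) (w (Suc ((i + t) mod n))) (w ((j + t) mod n)) (w (Suc ((j + t) mod n)))"
      by (simp add: w)
    from unique[OF _ _ this] n0 have "((i + t) mod n, (j + t) mod n) = (0, t) \<or> ((i + t) mod n, (j + t) mod n) = (t, 0)" by simp
    moreover have "(l + t) mod n = (if l + t < n then l + t else l + t - n)" if "l < n" for l
      using that t by (auto simp: mod_if)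
    ultimately show "(i, j) = (0, n - t) \<or> (i, j) = (n - t, 0)"
      using ij t n by (auto split: if_splits)
  qed (use t in auto)
  then show ?thesis by (simp add: open_hemisphere_range range_shift[OF P n0])
qed

lemma crossing_count_card:
  "crossing_count w n = card {(i, j). i < n \<and> j < n \<and> arcs_cross (w i) (w (Suc i)) (w j) (w (Suc j))}"
proof -
  let ?C = "{(i, j). i < n \<and> j < n \<and> arcs_cross (w i) (w (Suc i)) (w j) (w (Suc j))}"
  have "crossing_count w n = (\<Sum>(i, j)\<in>{..<n} \<times> {..<n}. of_bool (arcs_cross (w i) (w (Suc i)) (w j) (w (Suc j))))"
    unfolding crossing_count_def by (rule sum.cartesian_product)
  also have "\<dots> = (\<Sum>p\<in>{..<n} \<times> {..<n}. of_bool (p \<in> ?C))"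
    by (intro sum.cong) auto
  also have "\<dots> = card (({..<n} \<times> {..<n}) \<inter> ?C)"
    by (simp add: Int_def)
  also have "({..<n} \<times> {..<n}) \<inter> ?C = ?C" by auto
  finally show ?thesis .
qed

text \<open>Around a cycle a sign change must be undone, so a single one is impossible.\<close>

lemma constant_turns:
  assumes P: "polygon w n" and n: "3 \<le> n" and I: "inflection_count w n < 2"
  shows "left_turn w n i = left_turn w n 0"
proof -
  have n0: "0 < n" using n by simp
  have step: "left_turn w n (Suc i) = left_turn w n i" for i
  proof (rule ccontr)
    assume ne: "left_turn w n (Suc i) \<noteq> left_turn w n i"
    let ?V = "\<lambda>l. w (l + i)"
    have PV: "polygon ?V n" by (rule polygon_shift[OF P])
    let ?P = "left_turn ?V n"
    have "?P 0 \<noteq> ?P 1" using ne by (simp add: left_turn_shift[OF n0])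
    moreover have "?P n = ?P 0" using left_turn_period[OF PV n0, of 0] by simp
    ultimately obtain l where l: "1 \<le> l" "l < n" "?P l \<noteq> ?P (Suc l)"
      using turn_change[of 1 n ?P] n by auto
    have "card {0, l} = 2" using l by auto
    moreover have "card {0, l} \<le> inflection_count ?V n"
      unfolding inflection_count_card by (rule card_mono) (use l n0 \<open>?P 0 \<noteq> ?P 1\<close> in auto)
    ultimately show False using I by (simp add: inflection_count_shift[OF P n0])
  qed
  show ?thesis by (induction i) (use step in auto)
qed

lemma crossing_case:
  assumes IH: "\<And>m. 4 \<le> m \<Longrightarrow> m < n \<Longrightarrow> crossings_inflections_bound m" and P: "polygon w n" and n: "5 \<le> n"
    and not_simple: "\<not> simple_polygon w" and no: "\<not> open_hemisphere w"
  shows "4 \<le> crossing_count w n + inflection_count w n"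
proof (rule ccontr)
  assume less: "\<not> 4 \<le> crossing_count w n + inflection_count w n"
  have n0: "0 < n" "3 \<le> n" using n by auto
  have wm: "w (i mod n) = w i" "w (Suc (i mod n)) = w (Suc i)" for i
    using periodic_mod[of w n i] periodic_mod[of "\<lambda>i. w (Suc i)" n i] polygon_period[OF P] polygon_period[OF P, of "Suc _"]
    by auto
  obtain i j where "arcs_cross (w i) (w (Suc i)) (w j) (w (Suc j))"
    using not_simple by (auto simp: simple_polygon_def)
  then have "arcs_cross (w (i mod n)) (w (Suc (i mod n))) (w (j mod n)) (w (Suc (j mod n)))" by (simp add: wm)
  then obtain i j where ij: "i < n" "j < n" "arcs_cross (w i) (w (Suc i)) (w j) (w (Suc j))"
    using n0 mod_less_divisor by metis
  define W where "W l = w (l + i)" for l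
  define t where "t = (j + (n - i)) mod n"
  have PW: "polygon W n" unfolding W_def by (rule polygon_shift[OF P])
  have noW: "\<not> open_hemisphere W" using no unfolding W_def by (simp add: open_hemisphere_range range_shift[OF P n0(1)])
  have lessW: "crossing_count W n + inflection_count W n < 4"
    using less unfolding W_def by (simp add: crossing_count_shift[OF P] inflection_count_shift[OF P n0(1)])
  have "(t + i) mod n = (j + n) mod n" using ij(1) by (simp add: t_def mod_add_left_eq)
  then have ti: "(t + i) mod n = j" using ij by simp
  have tn: "t < n" using n0 by (simp add: t_def)
  have Wt: "W t = w j" "W (Suc t) = w (Suc j)" using wm[of "t + i"] ti by (simp_all add: W_def)
  have cross: "arcs_cross (W 0) (W 1) (W t) (W (Suc t))" using ij(3) Wt by (simp add: W_def)
  have Wn: "W n = W 0" using polygon_period[OF PW, of 0] by simp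
  have "t \<noteq> 0" "t \<noteq> 1" using cross by (auto intro: ccontr)
  moreover have "t \<noteq> n - 1" using cross Wn n by auto
  ultimately have t: "2 \<le> t" "t \<le> n - 2" using tn by auto
  let ?C = "{(i, j). i < n \<and> j < n \<and> arcs_cross (W i) (W (Suc i)) (W j) (W (Suc j))}"
  have "?C \<subseteq> {..<n} \<times> {..<n}" by auto
  then have fin: "finite ?C" by (rule finite_subset) simp
  have sub: "{(0, t), (t, 0)} \<subseteq> ?C" using cross arcs_cross_commute(1)[of "W 0" "W 1"] n0 tn by auto
  have "card {(0, t), (t, 0)} = 2" using t by simp
  \<comment> \<open>One crossing already contributes two ordered pairs, which leaves room for fewer
    than two inflections.\<close>
  then have "2 \<le> crossing_count W n"
    unfolding crossing_count_card using card_mono[OF fin sub] by simp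
  then have turns: "left_turn W n l = left_turn W n 0" for l
    using lessW by (intro constant_turns[OF PW n0(2)]) simp
  \<comment> \<open>A second crossing would bring the number of ordered pairs to four.\<close>
  have unique: "(k, l) = (0, t) \<or> (k, l) = (t, 0)" if "k < n" "l < n" "arcs_cross (W k) (W (Suc k)) (W l) (W (Suc l))" for k l
  proof (rule ccontr)
    assume "\<not> ?thesis"
    moreover have "k \<noteq> l" using that(3) by auto
    ultimately have 4: "card {(0, t), (t, 0), (k, l), (l, k)} = 4" using t by auto
    have sub4: "{(0, t), (t, 0), (k, l), (l, k)} \<subseteq> ?C"
      using that cross arcs_cross_commute(1)[of "W 0" "W 1"] arcs_cross_commute(1)[of "W k"] n0 tn by auto
    have "4 \<le> crossing_count W n"
      unfolding crossing_count_card using card_mono[OF fin sub4] by (simp only: 4)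
    then show False using lessW by simp
  qed
  show False
  proof (cases "left_turn W n 0")
    case True
    then show False using all_left_turns_hemisphere[OF IH PW n _ t cross unique] turns noW by blast
  next
    case False
    have "open_hemisphere (\<lambda>i. - W i)"
      by (rule all_left_turns_hemisphere[OF IH polygon_uminus[OF PW] n _ t])
        (use False turns cross unique in \<open>auto simp: left_turn_uminus[OF PW n0(2)] arcs_cross_uminus\<close>)
    then show False using noW by (simp add: open_hemisphere_uminus)
  qed
qed

section \<open>The bound for spherical polygons\<close>

lemma crossings_inflections_bound_all: "4 \<le> n \<Longrightarrow> crossings_inflections_bound n"
proof (induction n rule: less_induct)
  case (less n)
  show ?case
    unfolding crossings_inflections_bound_def
  proof (intro allI impI)
    fix w assume P: "polygon w n" and no: "\<not> open_hemisphere w"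
    show "4 \<le> crossing_count w n + inflection_count w n"
    proof (cases "n = 4")
      case True
      then show ?thesis using quadrilateral_inflections[of w] P no by simp
    next
      case False
      then have n: "5 \<le> n" using less.prems by simp
      show ?thesis
      proof (cases "simple_polygon w")
        case True
        then show ?thesis using simple_case[OF _ P n True no] less.IH by (simp add: trans_le_add2)
      next
        case False
        then show ?thesis using crossing_case[OF _ P n False no] less.IH by blast
      qed
    qed
  qed
qed

section \<open>Comparison with great-circle arcs, self-intersections and inflections\<close>

lemma normalized_in_sarc:
  assumes "\<alpha> > 0" "\<beta> > 0"
  shows "(\<alpha> *\<^sub>R a + \<beta> *\<^sub>R b) /\<^sub>R norm (\<alpha> *\<^sub>R a + \<beta> *\<^sub>R b) \<in> sarc a b"
proof -
  let ?v = "\<alpha> *\<^sub>R a + \<beta> *\<^sub>R b" and ?t = "\<beta> / (\<alpha> + \<beta>)"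
  have "1 - ?t = \<alpha> / (\<alpha> + \<beta>)" using assms by (simp add: field_simps)
  then have "(1 - ?t) *\<^sub>R a + ?t *\<^sub>R b = (1 / (\<alpha> + \<beta>)) *\<^sub>R ?v" by (simp add: scaleR_add_right)
  then have "?v /\<^sub>R norm ?v = ((1 - ?t) *\<^sub>R a + ?t *\<^sub>R b) /\<^sub>R norm ((1 - ?t) *\<^sub>R a + ?t *\<^sub>R b)"
    using assms by (simp add: abs_of_pos inverse_eq_divide)
  moreover have "?t \<in> {0..1}" using assms by (simp add: field_simps)
  ultimately show ?thesis unfolding sarc_def by blast
qed

lemma arcs_cross_sarc_intersect: "arcs_cross a b p q \<Longrightarrow> sarc a b \<inter> sarc p q \<noteq> {}"
  by (elim arcs_cross_imp_combination) (metis IntI empty_iff normalized_in_sarc)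

text \<open>A self-intersection gives at most two ordered crossing pairs. Equal or adjacent edges
  share an endpoint and are never counted by \<open>arcs_cross\<close>.\<close>

lemma crossing_count_le_self_intersections:
  assumes n: "4 \<le> n" and w: "w = vtx u n"
  shows "crossing_count w n \<le> 2 * card (self_intersections u n)"
proof -
  let ?C = "{(i, j). i < n \<and> j < n \<and> arcs_cross (w i) (w (Suc i)) (w j) (w (Suc j))}" and ?S = "self_intersections u n"
  have wn: "w n = w 0" by (simp add: w vtx_def)
  have "?S \<subseteq> {..<n} \<times> {..<n}" by (auto simp: self_intersections_def)
  then have fin: "finite ?S" by (rule finite_subset) simp
  have S: "(i, j) \<in> ?S" if "(i, j) \<in> ?C" "i < j" for i j
  proof -
    have c: "arcs_cross (w i) (w (Suc i)) (w j) (w (Suc j))" and j: "j < n" using that by auto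
    then have "j \<noteq> i + 1" "\<not> (i = 0 \<and> j = n - 1)" using wn n by auto
    moreover have "edge u n i \<inter> edge u n j \<noteq> {}"
      using arcs_cross_sarc_intersect[OF c] by (simp add: edge_def w)
    ultimately show ?thesis using that(2) j by (simp add: self_intersections_def)
  qed
  have "?C \<subseteq> ?S \<union> prod.swap ` ?S"
  proof
    fix p assume p: "p \<in> ?C"
    obtain i j where ij: "p = (i, j)" by (cases p)
    have "(j, i) \<in> ?C" using p ij arcs_cross_commute(1)[of "w i"] by auto
    moreover have "i \<noteq> j" using p ij by auto
    ultimately show "p \<in> ?S \<union> prod.swap ` ?S"
      using S[of i j] S[of j i] p ij by (cases "i < j") (force simp: image_iff)+
  qed
  then have "card ?C \<le> card (?S \<union> prod.swap ` ?S)" using fin by (intro card_mono) auto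
  also have "\<dots> \<le> card ?S + card (prod.swap ` ?S)" by (rule card_Un_le)
  also have "\<dots> \<le> 2 * card ?S" using card_image_le[OF fin, of prod.swap] by simp
  finally show ?thesis by (simp add: crossing_count_card)
qed

text \<open>The determinants of consecutive vertices do not vanish, so different turns amount to a
  negative product.\<close>

lemma inflection_count_eq_inflections:
  assumes P: "polygon w n" and n: "4 \<le> n" and w: "w = vtx u n"
  shows "inflection_count w n = card (inflections u n)"
proof -
  have "left_turn w n i \<noteq> left_turn w n (Suc i) \<longleftrightarrow>
      det3 (vtx u n (i + n - 1)) (vtx u n i) (vtx u n (i + 1)) * det3 (vtx u n i) (vtx u n (i + 1)) (vtx u n (i + 2)) < 0" for i
  proof -
    have e: "Suc (i + n - 1) = i + n" "Suc (i + n) = Suc i + n" using n by auto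
    have "det3 (w (i + n - 1)) (w i) (w (Suc i)) \<noteq> 0" "det3 (w i) (w (Suc i)) (w (Suc (Suc i))) \<noteq> 0"
      using polygon_det_nonzero[OF P, of "i + n - 1"] polygon_det_nonzero[OF P, of i] n
        polygon_period[OF P, of i] polygon_period[OF P, of "Suc i"] unfolding e by auto
    then show ?thesis
      unfolding left_turn_Suc[OF P] by (auto simp: left_turn_def w mult_less_0_iff)
  qed
  then show ?thesis unfolding inflection_count_card inflections_def by simp
qed

theorem theorem13:
  fixes u :: "nat \<Rightarrow> real^3" and n :: nat
  assumes "n \<ge> 4"
    and "\<forall>i<n. norm (u i) = 1"
    and "\<forall>i<n. \<forall>j<n. \<forall>k<n. i \<noteq> j \<and> j \<noteq> k \<and> i \<noteq> k \<longrightarrow> det3 (u i) (u j) (u k) \<noteq> 0"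
    and "\<not> in_closed_hemisphere u n"
  shows "2 * card (self_intersections u n) + card (inflections u n) \<ge> 4"
proof -
  let ?w = "vtx u n"
  have w: "?w i = u (i mod n)" for i by (simp add: vtx_def)
  have m: "i mod n < n" for i using assms(1) by simp
  have "inj_on ?w {..<n}"
  proof (rule inj_onI, rule ccontr)
    fix i j assume ij: "i \<in> {..<n}" "j \<in> {..<n}" "?w i = ?w j" "i \<noteq> j"
    \<comment> \<open>A third index is available, and a coincidence of two vertices would make its
      determinant with them vanish.\<close>
    have "\<not> {..<n} \<subseteq> {i, j}" using card_mono[of "{i, j}" "{..<n}"] assms(1) ij(4) by auto
    then obtain k where "k < n" "k \<noteq> i" "k \<noteq> j" by auto
    then have "det3 (u i) (u j) (u k) \<noteq> 0" using assms(3) ij by auto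
    then show False using ij by (simp add: w)
  qed
  moreover have "general_position (range ?w)"
    unfolding general_position_def w using assms(3) m by (auto simp: w) metis
  ultimately have P: "polygon ?w n" by (simp add: polygon_def w)
  have "\<not> open_hemisphere ?w"
  proof
    assume "open_hemisphere ?w"
    then obtain v where v: "\<And>i. v \<bullet> u (i mod n) > 0" by (auto simp: open_hemisphere_def w)
    have "v \<bullet> u i > 0" if "i < n" for i using v[of i] that by simp
    moreover have "v \<noteq> 0" using v[of 0] by auto
    ultimately show False using assms(4) by (auto simp: in_closed_hemisphere_def intro: less_imp_le)
  qed
  then have "4 \<le> crossing_count ?w n + inflection_count ?w n"
    using crossings_inflections_bound_all[OF assms(1)] P by (simp add: crossings_inflections_bound_def)
  then show ?thesis
    using crossing_count_le_self_intersections[OF assms(1) refl, of u] inflection_count_eq_inflections[OF P assms(1) refl]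
    by simp
qed

end
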